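(* Let $\{\lambda_n\}_{n=0}^\infty$ be a sequence in $\partial\mathbb{D}$, and let $\{\alpha_n\}_{n=0}^\infty$ and $\{\beta_n\}_{n=0}^\infty$ be sequences in $\mathbb{D}$ that are the Verblunsky coefficients of the measures $d\mu$ and $d\nu$ on $\partial\mathbb{D}$, respectively. Suppose that (i) $\beta_n\lambda_n-\alpha_n\to0$ as $n\to\infty$, and (ii) $\lambda_{n-1}\bar\lambda_n\to1$ as $n\to\infty$. Then the derived sets (sets of limit points) of $\operatorname{supp}(d\mu)$ and $\operatorname{supp}(d\nu)$ are equal, that is, up to a discrete set, $\operatorname{supp}(d\mu)$ and $\operatorname{supp}(d\nu)$ are equal.
   Context: $\mathbb{D}=\{|z|<1\}$. For a probability measure $\mu$ on $\partial\mathbb{D}$ that is not a finite combination of delta functions, $\Phi_n$ is the monic orthogonal polynomial of degree $n$ in $L^2(\partial\mathbb{D},d\mu)$ and the Verblunsky coefficients are $\alpha_n=-\overline{\Phi_{n+1}(0)}\in\mathbb{D}$, $n\ge0$. By Verblunsky's theorem every sequence in $\mathbb{D}$ is the sequence of Verblunsky coefficients of exactly one such measure. *)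

theory Defs
  imports
    "HOL-Analysis.Analysis"
    "HOL-Probability.Probability_Measure"
    "HOL-Computational_Algebra.Polynomial"
begin

definition circle_prob_measure :: "complex measure \<Rightarrow> bool" where
  "circle_prob_measure M \<longleftrightarrow>
     prob_space M \<and> sets M = sets (restrict_space borel (sphere 0 1))"

definition finite_comb_of_deltas :: "complex measure \<Rightarrow> bool" where
  "finite_comb_of_deltas M \<longleftrightarrow>
     (\<exists>F (c :: complex \<Rightarrow> real). finite F \<and> F \<subseteq> sphere 0 1 \<and>
        (\<forall>A\<in>sets M. measure M A = (\<Sum>w\<in>F. c w * indicator A w)))"

definition is_monic_OP :: "complex measure \<Rightarrow> nat \<Rightarrow> complex poly \<Rightarrow> bool" where
  "is_monic_OP M n p \<longleftrightarrow> degree p = n \<and> lead_coeff p = 1 \<and>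
     (\<forall>k<n. (LINT z|M. cnj (z ^ k) * poly p z) = 0)"

(* Existence and uniqueness hold for circle probability measures that are not
   finite combinations of delta functions; otherwise the value may be unspecified. *)
definition monic_OP :: "complex measure \<Rightarrow> nat \<Rightarrow> complex poly" where
  "monic_OP M n = (THE p. is_monic_OP M n p)"

definition verblunsky :: "complex measure \<Rightarrow> nat \<Rightarrow> complex" where
  "verblunsky M n = - cnj (poly (monic_OP M (Suc n)) 0)"

definition measure_supp :: "complex measure \<Rightarrow> complex set" where
  "measure_supp M =
     {z \<in> space M. \<forall>U. open U \<and> z \<in> U \<longrightarrow> emeasure M (U \<inter> space M) > 0}"

end

theory Submission
  imports Defs
begin

text \<open>In the CMV basis \<open>chi\<close> and its complex conjugate (the alternate CMV basis), multiplication by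
  \<open>1 - w cnj z\<close> is given for \<open>|w| = 1\<close> by an explicit symmetric tridiagonal matrix \<open>jac \<alpha> w\<close> built
  from the Verblunsky coefficients. Since \<open>|1 - w cnj z| = |z - w|\<close> on the circle, a point \<open>w\<close> is a
  limit point of the support iff there are finitely supported unit vectors, arbitrarily far out in
  the basis, that \<open>jac \<alpha> w\<close> makes arbitrarily small (Weyl's criterion, here the predicate
  \<open>weyl_point\<close>). Conditions (i) and (ii) say precisely that the diagonal unitary gauge
  \<open>c n \<mapsto> cnj (lam n) * c n\<close> for odd \<open>n\<close> turns \<open>jac \<alpha> w\<close> into \<open>jac \<beta> w\<close> up to entries tending to
  zero, so the two sets of limit points agree.\<close>

text \<open>The multiplier is \<open>1 - w * cnj z\<close> rather than \<open>z - w\<close> because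
  in a single CMV basis multiplication by \<open>z\<close> is five-diagonal, with products of
  neighbouring coefficients as entries. Between the basis and its conjugate every entry involves
  single coefficients or a single \<open>rho\<close>, so perturbing it costs only differences that
  (i) and (ii) control. As domain and range carry different bases, they may be gauged by different
  diagonal unitaries: odd coordinates of the vector, even rows of the image. After that, (i) matches
  each coefficient with the factor \<open>lam\<close> of its own index, and (ii) repairs the places
  where a neighbouring index appears instead. Weyl's criterion with escaping vectors sees exactly
  the limit points because multiplication by \<open>z\<close> has simple eigenvalues: an isolated
  point of the support is one atom, and vectors far out in the basis become nearly orthogonal to its
  eigenvector.\<close>

definition rho :: "complex \<Rightarrow> real" where
  "rho a = sqrt (1 - (cmod a)\<^sup>2)"

text \<open>Put the blocks \<open>((cnj a, rho a), (rho a, - a))\<close> with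
  \<open>a = \<alpha> n\<close> at the indices \<open>n, Suc n\<close>. Odd \<open>n\<close>,
  together with a 1 at index 0, give a block matrix M, even \<open>n\<close> a block matrix L; both
  are symmetric and, for coefficients in the disc, unitary, and LM is the CMV matrix. Away from row
  0, \<open>jac\<close> is M - z L^*, that is, L^* (LM - z).\<close>

definition jac_diag :: "(nat \<Rightarrow> complex) \<Rightarrow> complex \<Rightarrow> nat \<Rightarrow> complex" where
  "jac_diag \<alpha> z n =
     (if odd n then cnj (\<alpha> n) + z * cnj (\<alpha> (n - 1)) else - (\<alpha> (n - 1) + z * \<alpha> n))"

definition jac_off :: "(nat \<Rightarrow> complex) \<Rightarrow> complex \<Rightarrow> nat \<Rightarrow> complex" where
  "jac_off \<alpha> z n = (if odd n then of_real (rho (\<alpha> n)) else - z * of_real (rho (\<alpha> n)))"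

text \<open>Row \<open>0\<close> is junk (\<open>n - 1\<close> truncates): only vectors with \<open>c 0 = 0\<close> matter below.\<close>

definition jac :: "(nat \<Rightarrow> complex) \<Rightarrow> complex \<Rightarrow> (nat \<Rightarrow> complex) \<Rightarrow> nat \<Rightarrow> complex" where
  "jac \<alpha> z c n =
     jac_off \<alpha> z (n - 1) * c (n - 1) + jac_diag \<alpha> z n * c n + jac_off \<alpha> z n * c (Suc n)"

text \<open>The image is summed up to and including \<open>K\<close> because a tridiagonal matrix
  reaches one index past the support of \<open>c\<close>. Comparing two sums avoids normalising
  \<open>c\<close>.\<close>

definition weyl_point :: "(nat \<Rightarrow> complex) \<Rightarrow> complex \<Rightarrow> bool" where
  "weyl_point \<alpha> z \<longleftrightarrow> (\<forall>N. \<forall>\<epsilon>>0. \<exists>K c.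
     (\<forall>n<N. c n = 0) \<and> (\<forall>n\<ge>K. c n = 0) \<and> 0 < (\<Sum>n<K. (cmod (c n))\<^sup>2) \<and>
     (\<Sum>n\<le>K. (cmod (jac \<alpha> z c n))\<^sup>2) \<le> \<epsilon> * (\<Sum>n<K. (cmod (c n))\<^sup>2))"

section \<open>Gauge invariance of Weyl points\<close>

lemma rho_diff_le:
  assumes "cmod a < 1" "cmod b < 1"
  shows "\<bar>rho a - rho b\<bar> \<le> sqrt (2 * \<bar>cmod a - cmod b\<bar>)"
proof -
  \<comment> \<open>\<open>rho\<close> is not Lipschitz near the circle, and nothing keeps the
    coefficients away from it. Hoelder continuity of the square root survives there and suffices for
    limits.\<close>
  have *: "\<bar>sqrt x - sqrt y\<bar> \<le> sqrt \<bar>x - y\<bar>" if "0 \<le> x" "0 \<le> y" for x y :: real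
  proof -
    have "sqrt x \<le> sqrt y + sqrt \<bar>x - y\<bar>" "sqrt y \<le> sqrt x + sqrt \<bar>x - y\<bar>"
      using that sqrt_add_le_add_sqrt[of y "\<bar>x - y\<bar>"] sqrt_add_le_add_sqrt[of x "\<bar>x - y\<bar>"]
        real_sqrt_le_mono[of x "y + \<bar>x - y\<bar>"] real_sqrt_le_mono[of y "x + \<bar>x - y\<bar>"]
      by linarith+
    then show ?thesis by linarith
  qed
  have sq: "(cmod a)\<^sup>2 \<le> 1" "(cmod b)\<^sup>2 \<le> 1"
    using assms by (simp_all add: power_le_one)
  have "\<bar>(1 - (cmod a)\<^sup>2) - (1 - (cmod b)\<^sup>2)\<bar> = \<bar>cmod a - cmod b\<bar> * (cmod a + cmod b)"
  proof -
    have "(1 - (cmod a)\<^sup>2) - (1 - (cmod b)\<^sup>2) = - ((cmod a - cmod b) * (cmod a + cmod b))"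
      by (simp add: power2_eq_square algebra_simps)
    then show ?thesis by (simp add: abs_mult)
  qed
  also have "\<dots> \<le> \<bar>cmod a - cmod b\<bar> * 2"
    using assms by (intro mult_left_mono) auto
  finally have "sqrt \<bar>(1 - (cmod a)\<^sup>2) - (1 - (cmod b)\<^sup>2)\<bar> \<le> sqrt (2 * \<bar>cmod a - cmod b\<bar>)"
    by (simp add: mult.commute)
  then show ?thesis
    using *[of "1 - (cmod a)\<^sup>2" "1 - (cmod b)\<^sup>2"] sq unfolding rho_def by linarith
qed

lemma rho_le_1: "rho a \<le> 1"
  by (simp add: rho_def)

lemma rho_nonneg: "cmod a < 1 \<Longrightarrow> 0 \<le> rho a"
  by (simp add: rho_def power_le_one)

text \<open>Condition (i) pairs each coefficient with the factor of its own index; this allows the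
  factor of the next index at the price of a difference that (ii) sends to zero.\<close>

lemma norm_twist_le:
  fixes a b u v :: complex
  assumes "cmod u = 1" "cmod v = 1"
  shows "cmod (b * u - a) \<le> cmod (b * v - a) + cmod b * cmod (v - u)"
proof -
  have "b * u - a = (b * v - a) - b * (v - u)" by (simp add: algebra_simps)
  then show ?thesis
    by (metis norm_mult norm_triangle_ineq4)
qed

lemma norm_unit_mult_diff:
  assumes "cmod u = 1"
  shows "cmod (cnj u * a - b) = cmod (b * u - a)"
proof -
  have "u * cnj u = 1" using assms by (simp add: complex_norm_square[symmetric])
  then have "cnj u * a - b = - cnj u * (b * u - a)"
    by (simp add: algebra_simps)
  then show ?thesis using assms by (simp add: norm_mult)
qed

text \<open>Entry by entry: odd rows have ungauged even neighbours, so their off-diagonal entries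
  differ only in \<open>rho\<close>, while those of even rows also compare \<open>lam\<close> at
  adjacent indices. Every diagonal entry pairs the coefficient of index \<open>n-1\<close> with
  \<open>lam n\<close>. Since \<open>d\<close> bounds the sum of all these deviations, it bounds
  each of the three entries \<open>P\<close>, \<open>Q\<close>, \<open>S\<close>.\<close>

lemma jac_gauge_error:
  fixes lam \<alpha> \<beta> :: "nat \<Rightarrow> complex"
  assumes lam: "\<And>n. cmod (lam n) = 1" and z: "cmod z = 1"
    and al: "\<And>n. cmod (\<alpha> n) < 1" and be: "\<And>n. cmod (\<beta> n) < 1"
    and D: "cmod (\<beta> n * lam n - \<alpha> n) + cmod (\<beta> (n-1) * lam (n-1) - \<alpha> (n-1))
       + cmod (lam (n-1) - lam n) + cmod (lam n - lam (Suc n))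
       + \<bar>rho (\<alpha> n) - rho (\<beta> n)\<bar> + \<bar>rho (\<alpha> (n-1)) - rho (\<beta> (n-1))\<bar> \<le> d"
    and n: "0 < n"
    and c': "\<And>k. c' k = (if odd k then cnj (lam k) * c k else c k)"
  shows "cmod (jac \<beta> z c' n - (if odd n then 1 else cnj (lam n)) * jac \<alpha> z c n)
     \<le> d * (cmod (c (n-1)) + cmod (c n) + cmod (c (Suc n)))"
proof -
  define g where "g k = (if odd k then cnj (lam k) else 1)" for k
  define e where "e = (if odd n then 1 else cnj (lam n))"
  define P where "P = jac_off \<beta> z (n-1) * g (n-1) - e * jac_off \<alpha> z (n-1)"
  define Q where "Q = jac_diag \<beta> z n * g n - e * jac_diag \<alpha> z n"
  define S where "S = jac_off \<beta> z n * g (Suc n) - e * jac_off \<alpha> z n"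
  define e1 where "e1 k = cmod (\<beta> k * lam k - \<alpha> k)" for k
  define e3 where "e3 k = \<bar>rho (\<alpha> k) - rho (\<beta> k)\<bar>" for k
  have D': "e1 n + e1 (n-1) + cmod (lam (n-1) - lam n) + cmod (lam n - lam (Suc n))
      + e3 n + e3 (n-1) \<le> d"
    using D by (simp add: e1_def e3_def)
  have nn: "0 \<le> e1 k" "0 \<le> e3 k" for k by (simp_all add: e1_def e3_def)
  have cg: "c' k = g k * c k" for k by (simp add: c' g_def)
  have eq: "jac \<beta> z c' n - e * jac \<alpha> z c n = P * c (n-1) + Q * c n + S * c (Suc n)"
    by (simp add: jac_def cg P_def Q_def S_def algebra_simps)
  have r: "cmod (complex_of_real (rho (\<beta> k)) - complex_of_real (rho (\<alpha> k))) = e3 k" for k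
    by (metis e3_def abs_minus_commute norm_of_real of_real_diff)
  have cl: "cmod (cnj a - cnj b) = cmod (a - b)" for a b
    by (metis complex_cnj_diff complex_mod_cnj)
  have r': "cmod (complex_of_real (rho (\<beta> k)) * cnj u - cnj v * complex_of_real (rho (\<alpha> k)))
      \<le> e3 k + cmod (u - v)" if "cmod u = 1" "cmod v = 1" for k u v
  proof -
    have "complex_of_real (rho (\<beta> k)) * cnj u - cnj v * complex_of_real (rho (\<alpha> k))
       = (complex_of_real (rho (\<beta> k)) - complex_of_real (rho (\<alpha> k))) * cnj u
         + of_real (rho (\<alpha> k)) * (cnj u - cnj v)"
      by (simp add: algebra_simps)
    then have "cmod (complex_of_real (rho (\<beta> k)) * cnj u - cnj v * complex_of_real (rho (\<alpha> k)))
       \<le> cmod ((complex_of_real (rho (\<beta> k)) - complex_of_real (rho (\<alpha> k))) * cnj u)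
         + cmod (of_real (rho (\<alpha> k)) * (cnj u - cnj v))"
      by (metis norm_triangle_ineq)
    also have "\<dots> = e3 k + \<bar>rho (\<alpha> k)\<bar> * cmod (u - v)"
      using that by (simp add: norm_mult r cl)
    also have "\<dots> \<le> e3 k + 1 * cmod (u - v)"
      using rho_nonneg[OF al[of k]] rho_le_1[of "\<alpha> k"]
      by (intro add_left_mono mult_right_mono) auto
    finally show ?thesis by simp
  qed
  have tw: "cmod (\<beta> (n-1) * lam n - \<alpha> (n-1)) \<le> e1 (n-1) + cmod (lam (n-1) - lam n)"
  proof -
    have "cmod (\<beta> (n-1)) * cmod (lam (n-1) - lam n) \<le> 1 * cmod (lam (n-1) - lam n)"
      using be[of "n-1"] by (intro mult_right_mono) auto
    then show ?thesis
      using norm_twist_le[OF lam lam, of "\<beta> (n-1)" n "\<alpha> (n-1)" "n-1"]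
      by (simp add: e1_def)
  qed
  have "cmod P \<le> d \<and> cmod Q \<le> d \<and> cmod S \<le> d"
  proof (cases "odd n")
    case True
    then have ev: "even (n-1)" using n by simp
    have "P = - z * (of_real (rho (\<beta> (n-1))) - of_real (rho (\<alpha> (n-1))))"
      using True ev by (simp add: P_def jac_off_def g_def e_def algebra_simps)
    then have p: "cmod P = e3 (n-1)" using z by (simp add: norm_mult r)
    have "S = of_real (rho (\<beta> n)) - of_real (rho (\<alpha> n))"
      using True by (simp add: S_def jac_off_def g_def e_def)
    then have s: "cmod S = e3 n" by (simp add: r)
    have "Q = cnj (\<beta> n * lam n - \<alpha> n) + z * cnj (\<beta> (n-1) * lam n - \<alpha> (n-1))"
      using True by (simp add: Q_def jac_diag_def g_def e_def algebra_simps)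
    then have "cmod Q \<le> cmod (cnj (\<beta> n * lam n - \<alpha> n)) + cmod (z * cnj (\<beta> (n-1) * lam n - \<alpha> (n-1)))"
      by (metis norm_triangle_ineq)
    also have "\<dots> = e1 n + cmod (\<beta> (n-1) * lam n - \<alpha> (n-1))"
      unfolding norm_mult complex_mod_cnj z e1_def by simp
    finally show ?thesis using p s tw D' nn[of n] nn[of "n-1"]
        norm_ge_zero[of "lam (n-1) - lam n"] norm_ge_zero[of "lam n - lam (Suc n)"]
      by linarith
  next
    case False
    then have od: "odd (n-1)" using n by simp
    have "P = of_real (rho (\<beta> (n-1))) * cnj (lam (n-1)) - cnj (lam n) * of_real (rho (\<alpha> (n-1)))"
      using False od by (simp add: P_def jac_off_def g_def e_def)
    then have p: "cmod P \<le> e3 (n-1) + cmod (lam (n-1) - lam n)"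
      using r'[OF lam lam] by simp
    have "S = - z * (of_real (rho (\<beta> n)) * cnj (lam (Suc n)) - cnj (lam n) * of_real (rho (\<alpha> n)))"
      using False by (simp add: S_def jac_off_def g_def e_def algebra_simps)
    then have "cmod S = cmod (of_real (rho (\<beta> n)) * cnj (lam (Suc n)) - cnj (lam n) * of_real (rho (\<alpha> n)))"
      using z by (simp add: norm_mult)
    then have s: "cmod S \<le> e3 n + cmod (lam n - lam (Suc n))"
      using r'[OF lam lam, of n "Suc n" n] by (simp add: norm_minus_commute)
    have "Q = (cnj (lam n) * \<alpha> (n-1) - \<beta> (n-1)) + z * (cnj (lam n) * \<alpha> n - \<beta> n)"
      using False by (simp add: Q_def jac_diag_def g_def e_def algebra_simps)
    then have "cmod Q \<le> cmod (cnj (lam n) * \<alpha> (n-1) - \<beta> (n-1)) + cmod (z * (cnj (lam n) * \<alpha> n - \<beta> n))"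
      by (metis norm_triangle_ineq)
    also have "\<dots> = cmod (\<beta> (n-1) * lam n - \<alpha> (n-1)) + e1 n"
      unfolding norm_mult z e1_def norm_unit_mult_diff[OF lam] by simp
    finally show ?thesis using p s tw D' nn[of n] nn[of "n-1"]
        norm_ge_zero[of "lam (n-1) - lam n"] norm_ge_zero[of "lam n - lam (Suc n)"]
      by linarith
  qed
  then have "cmod (P * c (n-1)) \<le> d * cmod (c (n-1))" "cmod (Q * c n) \<le> d * cmod (c n)"
      "cmod (S * c (Suc n)) \<le> d * cmod (c (Suc n))"
    by (auto simp: norm_mult intro!: mult_right_mono)
  moreover have "cmod (P * c (n-1) + Q * c n + S * c (Suc n))
      \<le> cmod (P * c (n-1)) + cmod (Q * c n) + cmod (S * c (Suc n))"
    using norm_triangle_ineq[of "P * c (n-1) + Q * c n" "S * c (Suc n)"]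
      norm_triangle_ineq[of "P * c (n-1)" "Q * c n"] by linarith
  ultimately show ?thesis
    unfolding e_def[symmetric] eq by (simp add: algebra_simps)
qed

lemma power2_norm_add_le:
  fixes x y :: "'a::real_normed_vector"
  shows "(norm (x + y))\<^sup>2 \<le> 2 * (norm x)\<^sup>2 + 2 * (norm y)\<^sup>2"
proof -
  have "(norm (x + y))\<^sup>2 \<le> (norm x + norm y)\<^sup>2"
    by (intro power_mono norm_triangle_ineq norm_ge_zero)
  also have "\<dots> \<le> 2 * (norm x)\<^sup>2 + 2 * (norm y)\<^sup>2"
    using sum_squares_bound[of "norm x" "norm y"] by (simp add: power2_sum)
  finally show ?thesis .
qed

lemma power2_sum3_le:
  fixes x y w :: real
  shows "(x + y + w)\<^sup>2 \<le> 3 * (x\<^sup>2 + y\<^sup>2 + w\<^sup>2)"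
  using sum_squares_bound[of x y] sum_squares_bound[of x w] sum_squares_bound[of y w]
  by (simp add: power2_eq_square algebra_simps)

lemma weyl_point_transfer:
  fixes lam \<alpha> \<beta> :: "nat \<Rightarrow> complex"
  assumes lam: "\<And>n. cmod (lam n) = 1" and z: "cmod z = 1"
    and al: "\<And>n. cmod (\<alpha> n) < 1" and be: "\<And>n. cmod (\<beta> n) < 1"
    and lim1: "(\<lambda>n. \<beta> n * lam n - \<alpha> n) \<longlonglongrightarrow> 0"
    and lim2: "(\<lambda>n. lam (n - 1) * cnj (lam n)) \<longlonglongrightarrow> 1"
    and W: "weyl_point \<alpha> z"
  shows "weyl_point \<beta> z"
  unfolding weyl_point_def
proof (intro allI impI)
  fix N and \<epsilon> :: real assume "\<epsilon> > 0"
  define D where "D n = cmod (\<beta> n * lam n - \<alpha> n) + cmod (\<beta> (n-1) * lam (n-1) - \<alpha> (n-1))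
       + cmod (lam (n-1) - lam n) + cmod (lam n - lam (Suc n))
       + \<bar>rho (\<alpha> n) - rho (\<beta> n)\<bar> + \<bar>rho (\<alpha> (n-1)) - rho (\<beta> (n-1))\<bar>" for n
  have shift: "(\<lambda>n. f (n - 1)) \<longlonglongrightarrow> (0::real)" if "f \<longlonglongrightarrow> 0" for f :: "nat \<Rightarrow> real"
    by (rule LIMSEQ_imp_Suc) (use that in simp)
  have t1: "(\<lambda>n. cmod (\<beta> n * lam n - \<alpha> n)) \<longlonglongrightarrow> 0"
    using tendsto_norm[OF lim1] by simp
  have "cmod (lam (n-1) - lam n) = cmod (lam (n - 1) * cnj (lam n) - 1)" for n
    using norm_unit_mult_diff[OF lam, of n "lam (n-1)" 1]
    by (simp add: mult.commute norm_minus_commute)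
  then have t2: "(\<lambda>n. cmod (lam (n-1) - lam n)) \<longlonglongrightarrow> 0"
    using tendsto_norm[OF tendsto_diff[OF lim2 tendsto_const[of 1]]] by simp
  then have t2': "(\<lambda>n. cmod (lam n - lam (Suc n))) \<longlonglongrightarrow> 0"
    using LIMSEQ_Suc[OF t2] by simp
  have t3: "(\<lambda>n. \<bar>rho (\<alpha> n) - rho (\<beta> n)\<bar>) \<longlonglongrightarrow> 0"
  proof (rule tendsto_sandwich[OF _ _ tendsto_const])
    have *: "\<bar>cmod (\<alpha> n) - cmod (\<beta> n)\<bar> \<le> cmod (\<beta> n * lam n - \<alpha> n)" for n
      using norm_triangle_ineq3[of "\<alpha> n" "\<beta> n * lam n"] lam[of n]
      by (simp add: norm_mult norm_minus_commute)
    show "\<forall>\<^sub>F n in sequentially. \<bar>rho (\<alpha> n) - rho (\<beta> n)\<bar> \<le> sqrt (2 * cmod (\<beta> n * lam n - \<alpha> n))"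
      by (intro always_eventually allI order_trans[OF rho_diff_le[OF al be]] real_sqrt_le_mono
          mult_left_mono *) simp
    show "(\<lambda>n. sqrt (2 * cmod (\<beta> n * lam n - \<alpha> n))) \<longlonglongrightarrow> 0"
      using tendsto_real_sqrt[OF tendsto_mult[OF tendsto_const[of 2] t1]] by simp
  qed auto
  have "D \<longlonglongrightarrow> 0 + 0 + 0 + 0 + 0 + 0"
    unfolding D_def by (intro tendsto_add t1 t2 t2' t3 shift[OF t1] shift[OF t3])
  then have "D \<longlonglongrightarrow> 0" by simp
  \<comment> \<open>The bound 1 gives \<open>18 * d^2 \<le> 18 * d\<close>, and
    \<open>\<epsilon> / 36\<close> makes this at most \<open>\<epsilon> / 2\<close>. The other half
    is twice the tolerance \<open>\<epsilon> / 4\<close> asked of \<open>\<alpha>\<close>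
    below.\<close>
  moreover define d where "d = min 1 (\<epsilon> / 36)"
  moreover have d: "0 < d" using \<open>\<epsilon> > 0\<close> by (simp add: d_def)
  ultimately obtain N0 where N0: "\<And>n. n \<ge> N0 \<Longrightarrow> D n \<le> d"
    using order_tendstoD(2)[of D 0 sequentially d] unfolding eventually_sequentially
    by (metis less_imp_le)
  have d2: "18 * d\<^sup>2 \<le> \<epsilon> / 2"
  proof -
    have "d\<^sup>2 \<le> d * 1" unfolding power2_eq_square using d by (intro mult_left_mono) (auto simp: d_def)
    then show ?thesis unfolding d_def by linarith
  qed
  have "\<epsilon> / 4 > 0" using \<open>\<epsilon> > 0\<close> by simp
  \<comment> \<open>With this start, row 0 and every row \<open>n < N0\<close> see only zeros,
    including the entry at \<open>Suc n\<close>, so the gauge estimate is needed only where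
    \<open>D n \<le> d\<close>.\<close>
  with W obtain K c where c0: "\<forall>n < Suc N + N0 + 1. c n = 0" and cK: "\<forall>n\<ge>K. c n = 0"
    and pos: "0 < (\<Sum>n<K. (cmod (c n))\<^sup>2)"
    and le: "(\<Sum>n\<le>K. (cmod (jac \<alpha> z c n))\<^sup>2) \<le> \<epsilon> / 4 * (\<Sum>n<K. (cmod (c n))\<^sup>2)"
    unfolding weyl_point_def by blast
  define c' where "c' k = (if odd k then cnj (lam k) * c k else c k)" for k
  define C where "C = (\<Sum>n<K. (cmod (c n))\<^sup>2)"
  have nc': "cmod (c' k) = cmod (c k)" for k
    by (simp add: c'_def norm_mult lam)
  \<comment> \<open>The factor 2 comes from splitting off the gauged image, 3 from squaring a sum of
    three terms. The three shifted sums of squares of \<open>c\<close> all equal \<open>C\<close>,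
    whence \<open>18 * d^2\<close> later.\<close>
  have b: "(cmod (jac \<beta> z c' n))\<^sup>2 \<le> 2 * (cmod (jac \<alpha> z c n))\<^sup>2
     + 6 * d\<^sup>2 * ((cmod (c (n-1)))\<^sup>2 + (cmod (c n))\<^sup>2 + (cmod (c (Suc n)))\<^sup>2)" for n
  proof (cases "n < N0 \<or> n = 0")
    case True
    then have "c 0 = 0" "c (n-1) = 0" "c n = 0" "c (Suc n) = 0" using c0 by auto
    then have "jac \<beta> z c' n = 0" by (simp add: jac_def c'_def)
    then show ?thesis using d by simp
  next
    case False
    define e where "e = (if odd n then 1 else cnj (lam n))"
    have ne: "cmod e = 1" by (simp add: e_def lam)
    let ?T = "cmod (c (n-1)) + cmod (c n) + cmod (c (Suc n))"
    have "cmod (jac \<beta> z c' n - e * jac \<alpha> z c n) \<le> d * ?T"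
      unfolding e_def
      by (rule jac_gauge_error[OF lam z al be]) (use False N0[of n] in \<open>auto simp: c'_def D_def\<close>)
    then have "(cmod (jac \<beta> z c' n - e * jac \<alpha> z c n))\<^sup>2 \<le> (d * ?T)\<^sup>2"
      by (intro power_mono) auto
    also have "\<dots> \<le> d\<^sup>2 * (3 * ((cmod (c (n-1)))\<^sup>2 + (cmod (c n))\<^sup>2 + (cmod (c (Suc n)))\<^sup>2))"
      unfolding power_mult_distrib by (intro mult_left_mono power2_sum3_le) auto
    finally have "(cmod (jac \<beta> z c' n - e * jac \<alpha> z c n))\<^sup>2 \<le> \<dots>" .
    moreover have "(cmod (jac \<beta> z c' n))\<^sup>2 \<le> 2 * (cmod (e * jac \<alpha> z c n))\<^sup>2
        + 2 * (cmod (jac \<beta> z c' n - e * jac \<alpha> z c n))\<^sup>2"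
      using power2_norm_add_le[of "e * jac \<alpha> z c n" "jac \<beta> z c' n - e * jac \<alpha> z c n"] by simp
    ultimately show ?thesis by (simp add: norm_mult ne algebra_simps)
  qed
  have s1: "(\<Sum>n\<le>K. (cmod (c (n-1)))\<^sup>2) = C"
  proof -
    have "(\<Sum>n\<le>K. (cmod (c (n-1)))\<^sup>2) = (\<Sum>n<Suc K. (cmod (c (n-1)))\<^sup>2)"
      by (simp add: lessThan_Suc_atMost)
    also have "\<dots> = C" using c0 by (subst sum.lessThan_Suc_shift) (simp add: C_def)
    finally show ?thesis .
  qed
  have s2: "(\<Sum>n\<le>K. (cmod (c n))\<^sup>2) = C"
    using cK by (simp add: C_def flip: lessThan_Suc_atMost)
  have s3: "(\<Sum>n\<le>K. (cmod (c (Suc n)))\<^sup>2) = C"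
  proof -
    have "(\<Sum>n<Suc (Suc K). (cmod (c n))\<^sup>2) = C"
      using cK by (simp add: C_def)
    then show ?thesis using c0
      by (subst (asm) sum.lessThan_Suc_shift) (simp add: lessThan_Suc_atMost del: sum.lessThan_Suc)
  qed
  have "(\<Sum>n\<le>K. (cmod (jac \<beta> z c' n))\<^sup>2) \<le> (\<Sum>n\<le>K. 2 * (cmod (jac \<alpha> z c n))\<^sup>2
     + 6 * d\<^sup>2 * ((cmod (c (n-1)))\<^sup>2 + (cmod (c n))\<^sup>2 + (cmod (c (Suc n)))\<^sup>2))"
    by (intro sum_mono b)
  also have "\<dots> = 2 * (\<Sum>n\<le>K. (cmod (jac \<alpha> z c n))\<^sup>2) + 18 * d\<^sup>2 * C"
    by (simp add: sum.distrib s1[simplified] s2 s3 flip: sum_distrib_left)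
  also have "\<dots> \<le> 2 * (\<epsilon> / 4 * C) + \<epsilon> / 2 * C"
    using le d2 pos by (intro add_mono mult_right_mono) (auto simp: C_def)
  finally have "(\<Sum>n\<le>K. (cmod (jac \<beta> z c' n))\<^sup>2) \<le> \<epsilon> * (\<Sum>n<K. (cmod (c' n))\<^sup>2)"
    by (simp add: nc' C_def)
  moreover have "\<forall>n<N. c' n = 0" "\<forall>n\<ge>K. c' n = 0" "0 < (\<Sum>n<K. (cmod (c' n))\<^sup>2)"
    using c0 cK pos by (auto simp: c'_def norm_mult lam if_distrib cong: if_cong)
  ultimately show "\<exists>K c. (\<forall>n<N. c n = 0) \<and> (\<forall>n\<ge>K. c n = 0) \<and> 0 < (\<Sum>n<K. (cmod (c n))\<^sup>2) \<and>
     (\<Sum>n\<le>K. (cmod (jac \<beta> z c n))\<^sup>2) \<le> \<epsilon> * (\<Sum>n<K. (cmod (c n))\<^sup>2)"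
    by blast
qed

section \<open>Monic orthogonal polynomials and Szego's recursion\<close>

definition rev_poly :: "complex poly \<Rightarrow> complex poly" where
  "rev_poly p = reflect_poly (map_poly cnj p)"

lemma unit_mult_cnj: "cmod z = 1 \<Longrightarrow> z * cnj z = 1"
  by (simp flip: complex_norm_square)

text \<open>On the circle \<open>inverse z = cnj z\<close>, so reversing coefficients amounts to
  conjugating values, up to a power of \<open>z\<close>. Applied to an orthogonal polynomial this is
  Szego's reversed polynomial Phi_n^*.\<close>

lemma poly_rev_poly:
  assumes "cmod z = 1"
  shows "poly (rev_poly p) z = z ^ degree p * cnj (poly p z)"
proof -
  have "z \<noteq> 0" using assms by auto
  moreover have "inverse z = cnj z"
    by (rule inverse_unique[OF unit_mult_cnj[OF assms]])
  moreover have "degree (map_poly cnj p) = degree p" by (simp add: degree_map_poly)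
  ultimately show ?thesis
    by (metis rev_poly_def poly_reflect_poly_nz poly_cnj)
qed

lemma degree_rev_poly_le: "degree (rev_poly p) \<le> degree p"
  using degree_reflect_poly_le[of "map_poly cnj p"] by (simp add: rev_poly_def degree_map_poly)

lemma poly_rev_poly_0: "poly (rev_poly p) 0 = cnj (lead_coeff p)"
  by (simp add: rev_poly_def poly_0_coeff_0 degree_map_poly coeff_map_poly)

locale nontrivial_circle_measure =
  fixes M :: "complex measure"
  assumes circle_prob: "circle_prob_measure M"
    and nontrivial: "\<not> finite_comb_of_deltas M"
begin

sublocale prob_space M
  using circle_prob by (simp add: circle_prob_measure_def)

lemma sets_M: "sets M = sets (restrict_space borel (sphere 0 1))"
  using circle_prob by (simp add: circle_prob_measure_def)

lemma space_M: "space M = sphere 0 1"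
  using sets_eq_imp_space_eq[OF sets_M] by (simp add: space_restrict_space)

lemma norm_space: "z \<in> space M \<Longrightarrow> cmod z = 1"
  by (simp add: space_M)

lemma borel_Int_space_in_sets:
  assumes "A \<in> sets borel"
  shows "A \<inter> space M \<in> sets M"
  unfolding sets_M space_M using assms by (auto simp: sets_restrict_space)

lemma borel_measurable_circle:
  assumes "f \<in> borel_measurable borel"
  shows "f \<in> borel_measurable M"
  using measurable_restrict_space1[OF assms] measurable_cong_sets[OF sets_M refl] by blast

lemma integrable_circle:
  fixes f :: "complex \<Rightarrow> 'b::{banach, second_countable_topology}"
  assumes "continuous_on UNIV f"
  shows "integrable M f"
proof -
  have "compact (f ` sphere 0 1)"
    by (intro compact_continuous_image continuous_on_subset[OF assms]) auto
  then obtain B where "\<And>x. x \<in> sphere 0 1 \<Longrightarrow> norm (f x) \<le> B"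
    using compact_imp_bounded bounded_iff by (metis imageI)
  moreover have "f \<in> borel_measurable M"
    by (intro borel_measurable_circle borel_measurable_continuous_onI assms)
  ultimately show ?thesis
    by (intro integrable_const_bound[of f B]) (auto simp: space_M)
qed

text \<open>A vanishing integral would confine the measure to the finitely many roots of
  \<open>p\<close> on the circle, making it a finite combination of deltas.\<close>

lemma integral_norm_poly_pos:
  assumes "p \<noteq> 0"
  shows "0 < (LINT z|M. (cmod (poly p z))\<^sup>2)"
proof (rule ccontr)
  have int: "integrable M (\<lambda>z. (cmod (poly p z))\<^sup>2)"
    by (intro integrable_circle continuous_intros)
  assume "\<not> ?thesis"
  moreover have "0 \<le> (LINT z|M. (cmod (poly p z))\<^sup>2)" by simp
  ultimately have "(LINT z|M. (cmod (poly p z))\<^sup>2) = 0" by linarith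
  then have ae: "AE z in M. poly p z = 0"
    using integral_nonneg_eq_0_iff_AE[OF int] by simp
  define F where "F = {z \<in> space M. poly p z = 0}"
  have fin: "finite F"
    using poly_roots_finite[OF assms] by (simp add: F_def)
  have sing: "{w} \<in> sets M" if "w \<in> space M" for w
    using borel_Int_space_in_sets[of "{w}"] that by simp
  have Fs: "w \<in> F \<Longrightarrow> {w} \<in> sets M" for w
    by (rule sing) (simp add: F_def)
  have "measure M A = (\<Sum>w\<in>F. measure M {w} * indicator A w)" if A: "A \<in> sets M" for A
  proof -
    have sub: "A \<inter> F \<in> sets M"
    proof -
      have "(\<Union>w\<in>A \<inter> F. {w}) \<in> sets M"
        using fin Fs by (intro sets.finite_UN) auto
      then show ?thesis by simp
    qed
    have "measure M A = measure M (A \<inter> F)"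
      using ae A sub by (intro finite_measure_eq_AE) (auto simp: F_def)
    also have "\<dots> = (\<Sum>w\<in>A \<inter> F. measure M {w})"
      using fin Fs by (intro finite_measure_eq_sum_singleton) auto
    also have "\<dots> = (\<Sum>w\<in>F. measure M {w} * indicator A w)"
      using fin by (simp add: sum.inter_restrict Int_commute indicator_def if_distrib cong: if_cong)
    finally show ?thesis .
  qed
  then have "finite_comb_of_deltas M"
    unfolding finite_comb_of_deltas_def using fin
    by (intro exI[of _ F] exI[of _ "\<lambda>w. measure M {w}"]) (auto simp: F_def space_M)
  with nontrivial show False ..
qed

text \<open>Orthogonality to lower powers kills every term but the top one. Taking
  \<open>q = p\<close> gives the squared norm, \<open>degree q < n\<close> gives orthogonality to
  all polynomials of lower degree.\<close>

lemma monic_OP_pairing: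
  assumes p: "is_monic_OP M n p" and q: "degree q \<le> n"
  shows "(LINT z|M. cnj (poly q z) * poly p z)
       = cnj (coeff q n) * (LINT z|M. cnj (z ^ n) * poly p z)"
proof -
  have "poly q z = (\<Sum>i\<le>n. coeff q i * z ^ i)" for z
    by (subst poly_as_sum_of_monoms'[OF q, symmetric]) (simp add: poly_sum poly_monom)
  then have "(LINT z|M. cnj (poly q z) * poly p z)
      = (LINT z|M. (\<Sum>i\<le>n. cnj (coeff q i) * (cnj (z ^ i) * poly p z)))"
    by (simp add: sum_distrib_right mult.assoc)
  also have "\<dots> = (\<Sum>i\<le>n. cnj (coeff q i) * (LINT z|M. cnj (z ^ i) * poly p z))"
    by (subst Bochner_Integration.integral_sum) (auto intro!: integrable_circle continuous_intros)
  also have "\<dots> = (\<Sum>i\<in>{n}. cnj (coeff q i) * (LINT z|M. cnj (z ^ i) * poly p z))"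
    using p by (intro sum.mono_neutral_right) (auto simp: is_monic_OP_def)
  finally show ?thesis by simp
qed

lemma monic_OP_sq_norm:
  assumes p: "is_monic_OP M n p"
  shows "(LINT z|M. cnj (z ^ n) * poly p z) = of_real (LINT z|M. (cmod (poly p z))\<^sup>2)"
proof -
  have "(LINT z|M. cnj (z ^ n) * poly p z) = (LINT z|M. cnj (poly p z) * poly p z)"
    using monic_OP_pairing[OF p, of p] p by (auto simp: is_monic_OP_def)
  also have "\<dots> = (LINT z|M. complex_of_real ((cmod (poly p z))\<^sup>2))"
    by (intro Bochner_Integration.integral_cong refl) (simp only: complex_norm_square mult.commute)
  finally show ?thesis by (simp del: of_real_power)
qed

text \<open>Subtracting the right multiple of the reversed polynomial from \<open>z p\<close> restores
  orthogonality to the constants: this yields existence and the Szego recursion at once.\<close>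

lemma monic_OP_step:
  assumes p: "is_monic_OP M n p"
  obtains a where "is_monic_OP M (Suc n) (pCons 0 p - smult a (rev_poly p))"
proof -
  define h where "h = complex_of_real (LINT z|M. (cmod (poly p z))\<^sup>2)"
  have deg: "degree p = n" and lc: "lead_coeff p = 1" and p0: "p \<noteq> 0"
    using p by (auto simp: is_monic_OP_def)
  have orth: "(LINT z|M. cnj (z ^ k) * poly p z) = 0" if "k < n" for k
    using p that by (auto simp: is_monic_OP_def)
  have h: "h \<noteq> 0" using integral_norm_poly_pos[OF p0] by (simp add: h_def)
  \<comment> \<open>Conjugation reflects the exponent \<open>k\<close> to \<open>n - k\<close>.
    Hence the reversed polynomial is orthogonal to z, ..., z^n, and its pairing with 1 is
    nonzero.\<close>
  have rev: "(LINT z|M. cnj (z ^ k) * poly (rev_poly p) z) = cnj (LINT z|M. cnj (z ^ (n - k)) * poly p z)"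
    if "k \<le> n" for k
  proof -
    have "(LINT z|M. cnj (z ^ k) * poly (rev_poly p) z) = (LINT z|M. cnj (cnj (z ^ (n - k)) * poly p z))"
    proof (intro Bochner_Integration.integral_cong refl)
      fix z assume "z \<in> space M"
      then have z: "cmod z = 1" by (rule norm_space)
      have "z ^ n = z ^ k * z ^ (n - k)" using that by (simp flip: power_add)
      moreover have "cnj (z ^ k) * z ^ k = 1"
        using unit_mult_cnj[OF z] by (simp add: mult.commute flip: power_mult_distrib)
      ultimately show "cnj (z ^ k) * poly (rev_poly p) z = cnj (cnj (z ^ (n - k)) * poly p z)"
        by (simp add: poly_rev_poly[OF z] deg)
    qed
    then show ?thesis by (simp only: Bochner_Integration.integral_cnj)
  qed
  \<comment> \<open>For \<open>k = 0\<close> the reversed polynomial pairs to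
    \<open>cnj h = h\<close>, so this quotient cancels the pairing of \<open>z * p\<close> with
    1.\<close>
  define a where "a = (LINT z|M. z * poly p z) / h"
  define q where "q = pCons 0 p - smult a (rev_poly p)"
  have "degree (smult a (rev_poly p)) < degree (pCons 0 p)"
    using degree_rev_poly_le[of p] degree_smult_le[of a "rev_poly p"] p0 by simp
  then have "degree (- smult a (rev_poly p)) < degree (pCons 0 p)" by simp
  then have "degree q = degree (pCons 0 p)" "lead_coeff q = lead_coeff (pCons 0 p)"
    unfolding q_def diff_conv_add_uminus
    by (simp_all only: degree_add_eq_left) (simp add: coeff_eq_0 del: coeff_minus coeff_smult)
  then have "degree q = Suc n" "lead_coeff q = 1" using p0 deg lc by simp_all
  moreover have "(LINT z|M. cnj (z ^ k) * poly q z) = 0" if k: "k < Suc n" for k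
  proof -
    have "(LINT z|M. cnj (z ^ k) * poly q z)
        = (LINT z|M. cnj (z ^ k) * (z * poly p z) - a * (cnj (z ^ k) * poly (rev_poly p) z))"
      by (simp add: q_def algebra_simps)
    also have "\<dots> = (LINT z|M. cnj (z ^ k) * (z * poly p z)) - (LINT z|M. a * (cnj (z ^ k) * poly (rev_poly p) z))"
      by (intro Bochner_Integration.integral_diff integrable_circle continuous_intros)
    also have "(LINT z|M. a * (cnj (z ^ k) * poly (rev_poly p) z)) = a * cnj (LINT z|M. cnj (z ^ (n - k)) * poly p z)"
      using rev[of k] k by simp
    also have "(LINT z|M. cnj (z ^ k) * (z * poly p z)) = a * cnj (LINT z|M. cnj (z ^ (n - k)) * poly p z)"
    proof (cases k)
      case 0
      then show ?thesis
        using h by (simp add: monic_OP_sq_norm[OF p, simplified] a_def h_def)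
    next
      case (Suc j)
      have "(LINT z|M. cnj (z ^ k) * (z * poly p z)) = (LINT z|M. cnj (z ^ j) * poly p z)"
      proof (intro Bochner_Integration.integral_cong refl)
        fix z assume "z \<in> space M"
        then show "cnj (z ^ k) * (z * poly p z) = cnj (z ^ j) * poly p z"
          using unit_mult_cnj[OF norm_space, of z] by (simp add: Suc algebra_simps)
      qed
      then show ?thesis using orth[of j] orth[of "n - k"] Suc k by simp
    qed
    finally show ?thesis by simp
  qed
  ultimately have "is_monic_OP M (Suc n) q" by (simp add: is_monic_OP_def)
  then show ?thesis using that by (simp add: q_def)
qed

lemma monic_OP_unique:
  assumes p: "is_monic_OP M n p" and q: "is_monic_OP M n q"
  shows "p = q"
proof (rule ccontr)
  assume "p \<noteq> q"
  then have ne: "p - q \<noteq> 0" by simp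
  have "degree (p - q) \<le> n" "coeff (p - q) n = 0"
    using p q by (auto simp: is_monic_OP_def intro: degree_diff_le)
  then have "(LINT z|M. cnj (poly (p - q) z) * poly p z) = 0"
      "(LINT z|M. cnj (poly (p - q) z) * poly q z) = 0"
    using monic_OP_pairing[OF p, of "p - q"] monic_OP_pairing[OF q, of "p - q"] by simp_all
  moreover have "(LINT z|M. cnj (poly (p - q) z) * poly p z - cnj (poly (p - q) z) * poly q z)
     = (LINT z|M. cnj (poly (p - q) z) * poly p z) - (LINT z|M. cnj (poly (p - q) z) * poly q z)"
    by (intro Bochner_Integration.integral_diff integrable_circle continuous_intros)
  ultimately have "(LINT z|M. cnj (poly (p - q) z) * poly (p - q) z) = 0"
    by (simp add: algebra_simps)
  moreover have "(LINT z|M. cnj (poly (p - q) z) * poly (p - q) z)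
      = (LINT z|M. complex_of_real ((cmod (poly (p - q) z))\<^sup>2))"
    by (intro Bochner_Integration.integral_cong refl) (simp only: complex_norm_square mult.commute)
  ultimately show False
    using integral_norm_poly_pos[OF ne] by (simp del: of_real_power poly_diff)
qed

lemma is_monic_OP_monic_OP: "is_monic_OP M n (monic_OP M n)"
proof -
  have "\<exists>p. is_monic_OP M n p"
  proof (induction n)
    case 0
    show ?case by (rule exI[of _ 1]) (simp add: is_monic_OP_def)
  next
    case (Suc n)
    then show ?case using monic_OP_step by blast
  qed
  then show ?thesis unfolding monic_OP_def
    using monic_OP_unique by (metis theI)
qed

lemma monic_OP_0: "monic_OP M 0 = 1"
  by (rule monic_OP_unique[OF is_monic_OP_monic_OP]) (simp add: is_monic_OP_def)

lemma degree_monic_OP: "degree (monic_OP M n) = n"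
  and lead_coeff_monic_OP: "lead_coeff (monic_OP M n) = 1"
  using is_monic_OP_monic_OP[of n] unfolding is_monic_OP_def by blast+

text \<open>The multiplier is read off at 0, where \<open>pCons 0\<close> vanishes and the reversed
  monic polynomial equals 1.\<close>

lemma monic_OP_Suc:
  "monic_OP M (Suc n) =
     pCons 0 (monic_OP M n) - smult (cnj (verblunsky M n)) (rev_poly (monic_OP M n))"
proof -
  obtain a where "is_monic_OP M (Suc n) (pCons 0 (monic_OP M n) - smult a (rev_poly (monic_OP M n)))"
    using monic_OP_step[OF is_monic_OP_monic_OP] by blast
  then have eq: "monic_OP M (Suc n) = pCons 0 (monic_OP M n) - smult a (rev_poly (monic_OP M n))"
    by (rule monic_OP_unique[OF is_monic_OP_monic_OP])
  then have "a = cnj (verblunsky M n)"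
    by (simp add: verblunsky_def poly_rev_poly_0 lead_coeff_monic_OP)
  with eq show ?thesis by simp
qed

definition sq_norm :: "nat \<Rightarrow> real" where
  "sq_norm n = (LINT z|M. (cmod (poly (monic_OP M n) z))\<^sup>2)"

lemma sq_norm_pos: "0 < sq_norm n"
  unfolding sq_norm_def
  by (rule integral_norm_poly_pos) (metis lead_coeff_monic_OP leading_coeff_0_iff zero_neq_one)

lemma poly_monic_OP_Suc:
  assumes "cmod z = 1"
  shows "poly (monic_OP M (Suc n)) z = z * poly (monic_OP M n) z
     - cnj (verblunsky M n) * (z ^ n * cnj (poly (monic_OP M n) z))"
  by (simp add: monic_OP_Suc poly_rev_poly[OF assms] degree_monic_OP)

text \<open>Pythagoras: \<open>z * P z = Q z + a * R z\<close> on the circle, \<open>Q\<close> is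
  orthogonal to \<open>R\<close> because \<open>R\<close> has degree at most \<open>n\<close>, and
  \<open>z * P z\<close>, \<open>P z\<close> and \<open>R z\<close> have the same modulus.
  Positivity of both norms then forces the Verblunsky coefficients into the disc.\<close>

lemma sq_norm_Suc: "sq_norm (Suc n) = (1 - (cmod (verblunsky M n))\<^sup>2) * sq_norm n"
proof -
  define P where "P = poly (monic_OP M n)"
  define Q where "Q = poly (monic_OP M (Suc n))"
  define R where "R = poly (rev_poly (monic_OP M n))"
  define a where "a = cnj (verblunsky M n)"
  have cont: "continuous_on UNIV P" "continuous_on UNIV Q" "continuous_on UNIV R"
    by (auto simp: P_def Q_def R_def intro!: continuous_intros)
  have "(LINT z|M. cnj (R z) * Q z) = 0"
    unfolding R_def Q_def
    using monic_OP_pairing[OF is_monic_OP_monic_OP[of "Suc n"], of "rev_poly (monic_OP M n)"]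
      degree_rev_poly_le[of "monic_OP M n"] degree_monic_OP[of n]
    by (simp add: coeff_eq_0)
  then have RQ: "(LINT z|M. Re (cnj a * (cnj (R z) * Q z))) = 0"
    using cont by (subst integral_Re) (auto intro!: integrable_circle continuous_intros)
  have "(cmod (P z))\<^sup>2 = (cmod (Q z))\<^sup>2 + (cmod a)\<^sup>2 * (cmod (P z))\<^sup>2 + 2 * Re (cnj a * (cnj (R z) * Q z))"
    if "z \<in> space M" for z
  proof -
    have z: "cmod z = 1" by (rule norm_space[OF that])
    have R: "R z = z ^ n * cnj (P z)"
      by (simp add: R_def P_def poly_rev_poly[OF z] degree_monic_OP)
    then have nR: "cmod (R z) = cmod (P z)" by (simp add: norm_mult norm_power z)
    have "z * P z = Q z + a * R z"
      unfolding Q_def poly_monic_OP_Suc[OF z] R by (simp add: P_def a_def)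
    then have "cmod (P z) = cmod (Q z + a * R z)"
      using z by (metis mult_1 norm_mult)
    then have "(cmod (P z))\<^sup>2 = (cmod (Q z))\<^sup>2 + (cmod (a * R z))\<^sup>2 + 2 * Re (Q z * cnj (a * R z))"
      by (simp only: cmod_power2) (simp add: power2_eq_square algebra_simps)
    then show ?thesis by (simp add: norm_mult nR power_mult_distrib mult_ac)
  qed
  then have "(LINT z|M. (cmod (P z))\<^sup>2)
      = (LINT z|M. (cmod (Q z))\<^sup>2 + (cmod a)\<^sup>2 * (cmod (P z))\<^sup>2 + 2 * Re (cnj a * (cnj (R z) * Q z)))"
    by (intro Bochner_Integration.integral_cong) auto
  also have "\<dots> = (LINT z|M. (cmod (Q z))\<^sup>2) + (cmod a)\<^sup>2 * (LINT z|M. (cmod (P z))\<^sup>2)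
       + 2 * (LINT z|M. Re (cnj a * (cnj (R z) * Q z)))"
  proof -
    have "integrable M (\<lambda>z. (cmod (Q z))\<^sup>2)" "integrable M (\<lambda>z. (cmod a)\<^sup>2 * (cmod (P z))\<^sup>2)"
        "integrable M (\<lambda>z. 2 * Re (cnj a * (cnj (R z) * Q z)))"
      by (intro integrable_circle continuous_intros cont)+
    then show ?thesis
      by (simp only: Bochner_Integration.integral_add Bochner_Integration.integrable_add integral_mult_right_zero)
  qed
  finally show ?thesis
    unfolding RQ by (simp add: sq_norm_def P_def Q_def a_def algebra_simps)
qed

lemma norm_verblunsky_less_1: "cmod (verblunsky M n) < 1"
proof -
  have "0 < 1 - (cmod (verblunsky M n))\<^sup>2"
    using sq_norm_pos[of "Suc n", unfolded sq_norm_Suc] sq_norm_pos[of n] zero_less_mult_pos2 by blast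
  then show ?thesis by (simp add: abs_square_less_1)
qed

lemma rho_verblunsky_pos: "0 < rho (verblunsky M n)"
  using norm_verblunsky_less_1[of n] by (simp add: rho_def abs_square_less_1)

definition onp :: "nat \<Rightarrow> complex \<Rightarrow> complex" where
  "onp n z = poly (monic_OP M n) z / of_real (sqrt (sq_norm n))"

lemma continuous_on_onp [continuous_intros]:
  "continuous_on A f \<Longrightarrow> continuous_on A (\<lambda>x. onp n (f x))"
  using sq_norm_pos[of n] unfolding onp_def by (intro continuous_intros) auto

lemma onp_0: "onp 0 z = 1"
  by (simp add: onp_def monic_OP_0 sq_norm_def prob_space)

lemma integral_norm_onp: "(LINT z|M. (cmod (onp n z))\<^sup>2) = 1"
  using sq_norm_pos[of n]
  by (simp add: onp_def norm_divide power_divide flip: sq_norm_def)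

lemma onp_orthogonal:
  assumes "degree q < n"
  shows "(LINT z|M. cnj (poly q z) * onp n z) = 0"
  using monic_OP_pairing[OF is_monic_OP_monic_OP, of q n] assms
  by (simp add: onp_def coeff_eq_0)

text \<open>The ratio of consecutive norms is exactly \<open>rho\<close>; normalising therefore
  produces the entries of a unitary 2x2 block.\<close>

lemma szego_onp:
  assumes z: "cmod z = 1"
  shows "z * onp n z = cnj (verblunsky M n) * (z ^ n * cnj (onp n z))
     + of_real (rho (verblunsky M n)) * onp (Suc n) z"
proof -
  have s: "sqrt (sq_norm (Suc n)) = rho (verblunsky M n) * sqrt (sq_norm n)"
    by (simp add: sq_norm_Suc rho_def real_sqrt_mult)
  have "sqrt (sq_norm n) > 0" using sq_norm_pos by simp
  then show ?thesis
    unfolding onp_def s poly_monic_OP_Suc[OF z] using rho_verblunsky_pos[of n]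
    by (simp add: field_simps)
qed

end

section \<open>The CMV basis and its tridiagonal relation\<close>

lemma unit_cnj_power: "cmod z = 1 \<Longrightarrow> cnj z ^ k * z ^ k = 1"
  by (metis unit_mult_cnj mult.commute power_mult_distrib power_one)

text \<open>Szego's recursion supplies only the first row of a block. Its conjugate expresses
  \<open>p\<close> by \<open>u\<close> and \<open>v\<close>; eliminating \<open>u\<close> with the
  help of r^2 + |a|^2 = 1 leaves the second row times \<open>r\<close>.\<close>

lemma theta_solve:
  fixes a p q u v :: complex and r :: real
  assumes "u = a * p + of_real r * q" "p = cnj a * u + of_real r * v" "r \<noteq> 0" "r\<^sup>2 = 1 - (cmod a)\<^sup>2"
  shows "v = of_real r * p - cnj a * q"
proof -
  have aa: "cnj a * a = 1 - of_real r * of_real r"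
    using assms(4) by (metis complex_norm_square mult.commute of_real_1 of_real_diff
        of_real_power power2_eq_square diff_diff_eq2 add_diff_cancel_left' diff_add_cancel)
  have "of_real r * v = p - cnj a * u" using assms(2) by simp
  also have "\<dots> = p - (cnj a * a) * p - of_real r * (cnj a * q)"
    by (simp add: assms(1) algebra_simps)
  also have "\<dots> = of_real r * (of_real r * p - cnj a * q)"
    unfolding aa by (simp add: algebra_simps)
  finally show ?thesis using assms(3) by simp
qed

context nontrivial_circle_measure
begin

text \<open>The CMV basis of the measure; on the circle the alternate CMV basis is its complex
  conjugate.\<close>

definition chi :: "nat \<Rightarrow> complex \<Rightarrow> complex" where
  "chi n z = (if odd n then cnj z ^ (n div 2) * onp n z else z ^ (n div 2) * cnj (onp n z))"

lemma continuous_on_chi [continuous_intros]: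
  "continuous_on A f \<Longrightarrow> continuous_on A (\<lambda>x. chi n (f x))"
  by (cases "odd n") (auto simp: chi_def intro!: continuous_intros)

abbreviation "\<alpha> \<equiv> verblunsky M"

abbreviation "\<rho> n \<equiv> complex_of_real (rho (verblunsky M n))"

lemma chi_0: "chi 0 z = 1"
  by (simp add: chi_def onp_0)

text \<open>With \<open>n = Suc (2 * k)\<close> the prefactor \<open>cnj z ^ Suc k\<close> reduces
  \<open>z ^ n\<close> to \<open>z ^ k\<close>, so all powers of \<open>z\<close> are absorbed into
  \<open>chi\<close> and its conjugates and constant coefficients remain. For even \<open>n\<close>
  one factor \<open>cnj z\<close> survives; the two parities thus account for the two terms of
  \<open>1 - w * cnj z\<close>.\<close>

lemma chi_odd:
  assumes z: "cmod z = 1" and n: "odd n"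
  shows "chi n z = cnj (\<alpha> n) * cnj (chi n z) + \<rho> n * cnj (chi (Suc n) z)"
proof -
  obtain k where k: "n = Suc (2 * k)" using n by (elim oddE) simp
  have 1: "cnj z ^ Suc k * z = cnj z ^ k"
    using unit_cnj_power[OF z, of 1] by (simp add: mult.assoc)
  have 2: "cnj z ^ Suc k * z ^ n = z ^ k"
    using unit_cnj_power[OF z, of "Suc k"] by (simp add: k mult_2 power_add mult.assoc mult.left_commute)
  have "chi n z = cnj z ^ Suc k * (z * onp n z)"
    unfolding mult.assoc[symmetric] 1 by (simp add: chi_def k)
  also have "\<dots> = cnj (\<alpha> n) * ((cnj z ^ Suc k * z ^ n) * cnj (onp n z))
      + \<rho> n * (cnj z ^ Suc k * onp (Suc n) z)"
    unfolding szego_onp[OF z] by (simp only: ring_distribs mult_ac)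
  moreover have "cnj (chi n z) = z ^ k * cnj (onp n z)"
      "cnj (chi (Suc n) z) = cnj z ^ Suc k * onp (Suc n) z"
    by (simp_all add: chi_def k)
  ultimately show ?thesis unfolding 2 by presburger
qed

lemma chi_even:
  assumes z: "cmod z = 1" and n: "even n"
  shows "cnj z * chi n z = \<alpha> n * cnj (chi n z) + \<rho> n * cnj (chi (Suc n) z)"
proof -
  obtain k where k: "n = 2 * k" using n by (elim evenE) simp
  have 2: "cnj z ^ k * z ^ n = z ^ k"
    using unit_cnj_power[OF z, of k] by (simp add: k mult_2 power_add mult.assoc[symmetric])
  have "cnj (cnj z * chi n z) = cnj z ^ k * (z * onp n z)"
    by (simp add: chi_def k)
  also have "\<dots> = cnj (\<alpha> n) * ((cnj z ^ k * z ^ n) * cnj (onp n z))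
      + \<rho> n * (cnj z ^ k * onp (Suc n) z)"
    unfolding szego_onp[OF z] by (simp only: ring_distribs mult_ac)
  also have "\<dots> = cnj (\<alpha> n * cnj (chi n z) + \<rho> n * cnj (chi (Suc n) z))"
    unfolding 2 by (simp add: chi_def k)
  finally show ?thesis by (simp only: complex_cnj_cancel_iff)
qed

lemma rho_sq: "(rho (\<alpha> n))\<^sup>2 = 1 - (cmod (\<alpha> n))\<^sup>2"
  using norm_verblunsky_less_1[of n] by (simp add: rho_def power_le_one)

lemma chi_Suc_odd:
  assumes z: "cmod z = 1" and n: "odd n"
  shows "chi (Suc n) z = \<rho> n * cnj (chi n z) - \<alpha> n * cnj (chi (Suc n) z)"
proof -
  have "cnj (chi n z) = cnj (cnj (\<alpha> n)) * chi n z + \<rho> n * chi (Suc n) z"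
    using arg_cong[OF chi_odd[OF assms], of cnj] by simp
  from theta_solve[OF chi_odd[OF assms] this] rho_verblunsky_pos[of n] rho_sq[of n]
  show ?thesis by simp
qed

lemma chi_Suc_even:
  assumes z: "cmod z = 1" and n: "even n"
  shows "cnj z * chi (Suc n) z = \<rho> n * cnj (chi n z) - cnj (\<alpha> n) * cnj (chi (Suc n) z)"
proof -
  have "z * cnj (chi n z) = cnj (\<alpha> n) * chi n z + \<rho> n * chi (Suc n) z"
    using arg_cong[OF chi_even[OF assms], of cnj] by simp
  then have "cnj z * (z * cnj (chi n z)) = cnj (\<alpha> n) * (cnj z * chi n z) + \<rho> n * (cnj z * chi (Suc n) z)"
    by (simp add: algebra_simps)
  moreover have "cnj z * (z * cnj (chi n z)) = cnj (chi n z)"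
    using unit_cnj_power[OF z, of 1] by (simp flip: mult.assoc)
  ultimately have "cnj (chi n z) = cnj (\<alpha> n) * (cnj z * chi n z) + \<rho> n * (cnj z * chi (Suc n) z)"
    by simp
  from theta_solve[OF chi_even[OF assms] this] rho_verblunsky_pos[of n] rho_sq[of n]
  show ?thesis by simp
qed

text \<open>Each positive index lies in one odd and one even block. The odd block expands
  \<open>chi n\<close>, the even block expands \<open>cnj z * chi n\<close>, and each of them
  reaches one neighbour.\<close>

lemma jac_chi:
  assumes z: "cmod z = 1" and n: "0 < n"
  shows "(1 - w * cnj z) * chi n z = jac_off \<alpha> w (n - 1) * cnj (chi (n - 1) z)
     + jac_diag \<alpha> w n * cnj (chi n z) + jac_off \<alpha> w n * cnj (chi (Suc n) z)"
proof -
  obtain m where m: "n = Suc m" using n gr0_conv_Suc by blast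
  have d: "(1 - w * cnj z) * chi n z = chi n z - w * (cnj z * chi n z)"
    by (simp add: algebra_simps)
  show ?thesis
  proof (cases "odd n")
    case True
    then have "even m" using m by simp
    have "(1 - w * cnj z) * chi n z = (cnj (\<alpha> n) * cnj (chi n z) + \<rho> n * cnj (chi (Suc n) z))
       - w * (\<rho> m * cnj (chi m z) - cnj (\<alpha> m) * cnj (chi n z))"
      using d chi_odd[OF z True] chi_Suc_even[OF z \<open>even m\<close>] m by simp
    then show ?thesis using True \<open>even m\<close>
      by (simp add: jac_off_def jac_diag_def m algebra_simps)
  next
    case False
    then have "odd m" using m by simp
    have "(1 - w * cnj z) * chi n z = (\<rho> m * cnj (chi m z) - \<alpha> m * cnj (chi n z))
       - w * (\<alpha> n * cnj (chi n z) + \<rho> n * cnj (chi (Suc n) z))"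
      using d chi_even[OF z, of n] chi_Suc_odd[OF z \<open>odd m\<close>] m False by simp
    then show ?thesis using False \<open>odd m\<close>
      by (simp add: jac_off_def jac_diag_def m algebra_simps)
  qed
qed

text \<open>Collecting the coefficient of each \<open>cnj (chi n z)\<close> transposes the matrix,
  which changes nothing by symmetry. The assumption \<open>c 0 = 0\<close> removes the one term to
  which \<open>jac_chi\<close> does not apply.\<close>

lemma jac_sum_chi:
  assumes z: "cmod z = 1" and c0: "c 0 = 0" and cK: "\<And>n. n \<ge> K \<Longrightarrow> c n = 0"
  shows "(1 - w * cnj z) * (\<Sum>n<K. c n * chi n z) = (\<Sum>n\<le>K. jac \<alpha> w c n * cnj (chi n z))"
proof -
  define T where "T n = (1 - w * cnj z) * (c n * chi n z)" for n
  have T: "T n = c n * (jac_off \<alpha> w (n - 1) * cnj (chi (n - 1) z)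
     + jac_diag \<alpha> w n * cnj (chi n z) + jac_off \<alpha> w n * cnj (chi (Suc n) z))" for n
  proof (cases "n = 0")
    case False
    then show ?thesis unfolding T_def mult.left_commute[of _ "c n"] by (simp only: jac_chi[OF z])
  qed (simp add: T_def c0)
  \<comment> \<open>Cutting at \<open>k\<close> severs one symmetric pair of entries: a term on the
    left already reaches \<open>Suc k\<close>, and row \<open>k\<close> on the right already uses
    \<open>c (Suc k)\<close>. Both corrections vanish at \<open>k = K\<close>.\<close>
  have "(\<Sum>n<Suc k. T n) = (\<Sum>n<Suc k. jac \<alpha> w c n * cnj (chi n z))
     + jac_off \<alpha> w k * c k * cnj (chi (Suc k) z) - jac_off \<alpha> w k * c (Suc k) * cnj (chi k z)" for k
  proof (induction k)
    case 0
    show ?case by (simp add: T c0 jac_def)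
  next
    case (Suc k)
    have "(\<Sum>n<Suc (Suc k). T n) = (\<Sum>n<Suc k. T n) + T (Suc k)" by simp
    also have "\<dots> = (\<Sum>n<Suc k. jac \<alpha> w c n * cnj (chi n z))
     + jac_off \<alpha> w k * c k * cnj (chi (Suc k) z) - jac_off \<alpha> w k * c (Suc k) * cnj (chi k z) + T (Suc k)"
      unfolding Suc.IH ..
    also have "\<dots> = (\<Sum>n<Suc k. jac \<alpha> w c n * cnj (chi n z)) + jac \<alpha> w c (Suc k) * cnj (chi (Suc k) z)
     + jac_off \<alpha> w (Suc k) * c (Suc k) * cnj (chi (Suc (Suc k)) z)
     - jac_off \<alpha> w (Suc k) * c (Suc (Suc k)) * cnj (chi (Suc k) z)"
      unfolding T jac_def by (simp add: algebra_simps del: sum.lessThan_Suc)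
    finally show ?case by simp
  qed
  from this[of K] have "(\<Sum>n<Suc K. T n) = (\<Sum>n\<le>K. jac \<alpha> w c n * cnj (chi n z))"
    using cK by (simp add: lessThan_Suc_atMost del: sum.lessThan_Suc)
  moreover have "(\<Sum>n<Suc K. T n) = (1 - w * cnj z) * (\<Sum>n<K. c n * chi n z)"
    using cK by (simp add: T_def sum_distrib_left)
  ultimately show ?thesis by simp
qed

section \<open>Orthonormality of the CMV basis and Parseval's identity\<close>

lemma onp_orthogonal_shift:
  assumes "k + m < n"
  shows "(LINT z|M. cnj (z ^ k * onp m z) * onp n z) = 0"
    and "(LINT z|M. cnj (z ^ k * (z ^ m * cnj (onp m z))) * onp n z) = 0"
proof -
  define s where "s = complex_of_real (sqrt (sq_norm m))"
  have deg: "degree (monom 1 k * smult (1 / s) q) < n" if "degree q \<le> m" for q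
  proof -
    have "degree (monom 1 k * smult (1 / s) q) \<le> degree (monom (1::complex) k) + degree (smult (1 / s) q)"
      by (rule degree_mult_le)
    also have "\<dots> \<le> k + m"
      using that degree_monom_le[of "1::complex" k] degree_smult_le[of "1 / s" q] by linarith
    finally show ?thesis using assms by linarith
  qed
  have "(LINT z|M. cnj (poly (monom 1 k * smult (1 / s) (monic_OP M m)) z) * onp n z) = 0"
    by (intro onp_orthogonal deg) (simp add: degree_monic_OP)
  then show "(LINT z|M. cnj (z ^ k * onp m z) * onp n z) = 0"
    by (simp add: poly_monom onp_def[of m] s_def)
  have "(LINT z|M. cnj (poly (monom 1 k * smult (1 / s) (rev_poly (monic_OP M m))) z) * onp n z) = 0"
    using degree_rev_poly_le[of "monic_OP M m"] degree_monic_OP[of m]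
    by (intro onp_orthogonal deg) simp
  moreover have "cnj (poly (monom 1 k * smult (1 / s) (rev_poly (monic_OP M m))) z) * onp n z
      = cnj (z ^ k * (z ^ m * cnj (onp m z))) * onp n z" if "z \<in> space M" for z
    by (simp add: poly_monom onp_def[of m] s_def poly_rev_poly[OF norm_space[OF that]] degree_monic_OP)
  ultimately show "(LINT z|M. cnj (z ^ k * (z ^ m * cnj (onp m z))) * onp n z) = 0"
    by (metis (no_types, lifting) Bochner_Integration.integral_cong)
qed

text \<open>After powers of \<open>z\<close> cancel, equal parities pair \<open>onp n\<close> with a
  shifted \<open>onp m\<close>, opposite parities with a shifted reversal of it. Halving the indices
  in \<open>chi\<close> keeps the degree of the shifted factor below \<open>n\<close>.\<close>

lemma chi_orthogonal_less:
  assumes "m < n"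
  shows "(LINT z|M. cnj (chi m z) * chi n z) = 0"
proof -
  define a where "a = m div 2"
  define b where "b = n div 2"
  have pw: "cnj z ^ j * z ^ i = cnj z ^ (j - i)" if "cmod z = 1" "i \<le> j" for z i j
  proof -
    have "cnj z ^ j = cnj z ^ (j - i) * cnj z ^ i" using that by (simp flip: power_add)
    then show ?thesis using unit_cnj_power[OF that(1), of i] by (simp add: mult.assoc)
  qed
  have trans: "(LINT z|M. f z) = 0" if "(LINT z|M. g z) = 0" "\<And>z. cmod z = 1 \<Longrightarrow> f z = g z"
    for f g :: "complex \<Rightarrow> complex"
  proof -
    have "(LINT z|M. f z) = (LINT z|M. g z)"
      by (intro Bochner_Integration.integral_cong refl that(2) norm_space)
    then show ?thesis using that(1) by simp
  qed
  show ?thesis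
  proof (cases "odd n")
    case True
    then have n: "n = Suc (2 * b)" by (simp add: b_def)
    show ?thesis
    proof (cases "odd m")
      case odd: True
      then have m: "m = Suc (2 * a)" by (simp add: a_def)
      have ab: "a \<le> b" "b - a + m < n" using assms m n by auto
      show ?thesis
        by (rule trans[OF onp_orthogonal_shift(1)[OF ab(2)]])
          (use odd True pw[OF _ ab(1)] in \<open>simp add: chi_def a_def[symmetric] b_def[symmetric] mult_ac\<close>)
    next
      case even: False
      then have m: "m = 2 * a" by (simp add: a_def)
      have ab: "a \<le> b" "b - a + m < n" "m + (b - a) = a + b" using assms m n by auto
      show ?thesis
        by (rule trans[OF onp_orthogonal_shift(2)[OF ab(2)]])
          (use even True ab(3) in \<open>simp add: chi_def a_def[symmetric] b_def[symmetric] mult_ac flip: power_add\<close>)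
    qed
  next
    case False
    then have n: "n = 2 * b" by (simp add: b_def)
    \<comment> \<open>For even \<open>n\<close> the function \<open>chi n\<close> contains the
      conjugate of \<open>onp n\<close>; conjugating the integrand restores the form in which
      orthogonality is available.\<close>
    have "(LINT z|M. cnj (cnj (chi m z) * chi n z)) = 0"
    proof (cases "odd m")
      case odd: True
      then have m: "m = Suc (2 * a)" by (simp add: a_def)
      have ab: "b - Suc a + m < n" "m + (b - Suc a) = a + b" using assms m n by auto
      show ?thesis
        by (rule trans[OF onp_orthogonal_shift(2)[OF ab(1)]])
          (use odd False ab(2) in \<open>simp add: chi_def a_def[symmetric] b_def[symmetric] mult_ac flip: power_add\<close>)
    next
      case even: False
      then have m: "m = 2 * a" by (simp add: a_def)
      have ab: "a \<le> b" "b - a + m < n" using assms m n by auto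
      show ?thesis
        by (rule trans[OF onp_orthogonal_shift(1)[OF ab(2)]])
          (use even False pw[OF _ ab(1)] in \<open>simp add: chi_def a_def[symmetric] b_def[symmetric] mult_ac\<close>)
    qed
    then show ?thesis by (simp only: Bochner_Integration.integral_cnj complex_cnj_zero_iff)
  qed
qed

lemma chi_orthonormal: "(LINT z|M. cnj (chi m z) * chi n z) = (if m = n then 1 else 0)"
proof (cases m n rule: linorder_cases)
  case greater
  have "(LINT z|M. cnj (chi m z) * chi n z) = (LINT z|M. cnj (cnj (chi n z) * chi m z))"
    by (simp add: mult.commute)
  also have "\<dots> = 0"
    by (simp only: Bochner_Integration.integral_cnj chi_orthogonal_less[OF greater] complex_cnj_zero)
  finally show ?thesis using greater by simp
next
  case equal
  have "(LINT z|M. cnj (chi n z) * chi n z) = (LINT z|M. complex_of_real ((cmod (onp n z))\<^sup>2))"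
  proof (intro Bochner_Integration.integral_cong refl)
    fix z assume "z \<in> space M"
    then have "cmod (chi n z) = cmod (onp n z)"
      by (simp add: chi_def norm_mult norm_power norm_space)
    then show "cnj (chi n z) * chi n z = complex_of_real ((cmod (onp n z))\<^sup>2)"
      by (metis complex_norm_square mult.commute)
  qed
  also have "\<dots> = 1" by (simp only: integral_complex_of_real integral_norm_onp of_real_1)
  finally show ?thesis using equal by simp
qed (simp add: chi_orthogonal_less)

lemma integral_chi_sum:
  assumes "m < K"
  shows "(LINT z|M. cnj (chi m z) * (\<Sum>n<K. c n * chi n z)) = c m"
proof -
  have "(LINT z|M. cnj (chi m z) * (\<Sum>n<K. c n * chi n z))
      = (LINT z|M. (\<Sum>n<K. c n * (cnj (chi m z) * chi n z)))"
    by (simp add: sum_distrib_left mult_ac)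
  also have "\<dots> = (\<Sum>n<K. c n * (LINT z|M. cnj (chi m z) * chi n z))"
    by (subst Bochner_Integration.integral_sum) (auto intro!: integrable_circle continuous_intros)
  also have "\<dots> = c m" using assms by (simp add: chi_orthonormal if_distrib cong: if_cong)
  finally show ?thesis .
qed

lemma integral_norm_chi_sum:
  "(LINT z|M. (cmod (\<Sum>n<K. c n * chi n z))\<^sup>2) = (\<Sum>n<K. (cmod (c n))\<^sup>2)"
proof -
  have "complex_of_real (LINT z|M. (cmod (\<Sum>n<K. c n * chi n z))\<^sup>2)
      = (LINT z|M. complex_of_real ((cmod (\<Sum>n<K. c n * chi n z))\<^sup>2))"
    by (simp only: integral_complex_of_real)
  also have "\<dots> = (LINT z|M. cnj (\<Sum>m<K. c m * chi m z) * (\<Sum>n<K. c n * chi n z))"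
    by (intro Bochner_Integration.integral_cong refl) (simp only: complex_norm_square mult.commute)
  also have "\<dots> = (LINT z|M. (\<Sum>m<K. cnj (c m) * (cnj (chi m z) * (\<Sum>n<K. c n * chi n z))))"
    by (simp add: sum_distrib_right mult.assoc)
  also have "\<dots> = (\<Sum>m<K. cnj (c m) * (LINT z|M. cnj (chi m z) * (\<Sum>n<K. c n * chi n z)))"
    by (subst Bochner_Integration.integral_sum) (auto intro!: integrable_circle continuous_intros)
  also have "\<dots> = (\<Sum>m<K. cnj (c m) * c m)"
    by (intro sum.cong refl) (simp add: integral_chi_sum)
  also have "\<dots> = complex_of_real (\<Sum>m<K. (cmod (c m))\<^sup>2)"
    by (simp only: of_real_sum complex_norm_square mult.commute)
  finally show ?thesis by (simp only: of_real_eq_iff)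
qed

text \<open>On the circle |z - w| = |1 - w cnj z|, so \<open>jac_sum_chi\<close> applies.
  Conjugating its right-hand side gives a sum in \<open>chi\<close> with coefficients of the same
  moduli, to which Parseval applies.\<close>

lemma integral_norm_jac:
  assumes c0: "c 0 = 0" and cK: "\<And>n. n \<ge> K \<Longrightarrow> c n = 0"
  shows "(LINT z|M. (cmod (z - w))\<^sup>2 * (cmod (\<Sum>n<K. c n * chi n z))\<^sup>2)
       = (\<Sum>n\<le>K. (cmod (jac \<alpha> w c n))\<^sup>2)"
proof -
  have "(LINT z|M. (cmod (z - w))\<^sup>2 * (cmod (\<Sum>n<K. c n * chi n z))\<^sup>2)
      = (LINT z|M. (cmod (\<Sum>n<Suc K. cnj (jac \<alpha> w c n) * chi n z))\<^sup>2)"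
  proof (intro Bochner_Integration.integral_cong refl)
    fix z assume "z \<in> space M"
    then have z: "cmod z = 1" by (rule norm_space)
    have "z * (1 - w * cnj z) = z - w * (z * cnj z)" by (simp add: algebra_simps)
    also have "\<dots> = z - w" by (simp only: unit_mult_cnj[OF z] mult_1_right)
    finally have "cmod (z - w) = cmod (1 - w * cnj z)" using z by (metis mult_1 norm_mult)
    then have "cmod (z - w) * cmod (\<Sum>n<K. c n * chi n z) = cmod (\<Sum>n\<le>K. jac \<alpha> w c n * cnj (chi n z))"
      using jac_sum_chi[where c=c and K=K and w=w, OF z c0 cK] by (metis norm_mult)
    also have "\<dots> = cmod (cnj (\<Sum>n\<le>K. jac \<alpha> w c n * cnj (chi n z)))"
      by (simp only: complex_mod_cnj)
    also have "\<dots> = cmod (\<Sum>n<Suc K. cnj (jac \<alpha> w c n) * chi n z)"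
      by (simp add: lessThan_Suc_atMost del: sum.lessThan_Suc)
    finally show "(cmod (z - w))\<^sup>2 * (cmod (\<Sum>n<K. c n * chi n z))\<^sup>2
        = (cmod (\<Sum>n<Suc K. cnj (jac \<alpha> w c n) * chi n z))\<^sup>2"
      by (simp only: power_mult_distrib[symmetric])
  qed
  also have "\<dots> = (\<Sum>n<Suc K. (cmod (cnj (jac \<alpha> w c n)))\<^sup>2)"
    by (rule integral_norm_chi_sum)
  finally show ?thesis by (simp only: complex_mod_cnj lessThan_Suc_atMost)
qed

section \<open>Density of finite CMV sums\<close>

definition chi_span :: "(complex \<Rightarrow> complex) set" where
  "chi_span = {f. \<exists>K c. \<forall>z. cmod z = 1 \<longrightarrow> f z = (\<Sum>n<K. c n * chi n z)}"

text \<open>Membership looks only at the circle, since the block relations rest on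
  \<open>z * cnj z = 1\<close>.\<close>

lemma chi_span_cong:
  "f \<in> chi_span \<Longrightarrow> (\<And>z. cmod z = 1 \<Longrightarrow> f z = g z) \<Longrightarrow> g \<in> chi_span"
  unfolding chi_span_def by (simp; metis)

lemma chi_span_add:
  assumes "f \<in> chi_span" "g \<in> chi_span"
  shows "(\<lambda>z. f z + g z) \<in> chi_span"
proof -
  obtain K c where c: "\<And>z. cmod z = 1 \<Longrightarrow> f z = (\<Sum>n<K. c n * chi n z)"
    using assms(1) by (auto simp: chi_span_def)
  obtain L d where d: "\<And>z. cmod z = 1 \<Longrightarrow> g z = (\<Sum>n<L. d n * chi n z)"
    using assms(2) by (auto simp: chi_span_def)
  have pad: "(\<Sum>n<I. b n * chi n z) = (\<Sum>n<max K L. (if n < I then b n else 0) * chi n z)"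
    if "I \<le> max K L" for I b z
  proof -
    have "(\<Sum>n<max K L. (if n < I then b n else 0) * chi n z) = (\<Sum>n<I. (if n < I then b n else 0) * chi n z)"
      using that by (intro sum.mono_neutral_right) auto
    then show ?thesis by simp
  qed
  have "f z + g z = (\<Sum>n<max K L. ((if n < K then c n else 0) + (if n < L then d n else 0)) * chi n z)"
    if "cmod z = 1" for z
    unfolding c[OF that] d[OF that] pad[of K c z, OF max.cobounded1] pad[of L d z, OF max.cobounded2]
    by (simp only: sum.distrib ring_distribs)
  then show ?thesis unfolding chi_span_def
    by (intro CollectI exI[of _ "max K L"]
        exI[of _ "\<lambda>n. (if n < K then c n else 0) + (if n < L then d n else 0)"]) simp
qed

lemma chi_span_scale:
  assumes "f \<in> chi_span"
  shows "(\<lambda>z. a * f z) \<in> chi_span"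
proof -
  obtain K c where c: "\<And>z. cmod z = 1 \<Longrightarrow> f z = (\<Sum>n<K. c n * chi n z)"
    using assms by (auto simp: chi_span_def)
  have "a * f z = (\<Sum>n<K. (a * c n) * chi n z)" if "cmod z = 1" for z
    by (simp add: c[OF that] sum_distrib_left mult.assoc)
  then show ?thesis unfolding chi_span_def by (intro CollectI exI[of _ K] exI[of _ "\<lambda>n. a * c n"]) simp
qed

lemma chi_in_span: "chi n \<in> chi_span"
  unfolding chi_span_def
  by (intro CollectI exI[of _ "Suc n"] exI[of _ "\<lambda>k. if k = n then 1 else 0"])
    (simp add: if_distrib if_distribR cong: if_cong)

lemma chi_span_lincomb:
  assumes "\<And>z. cmod z = 1 \<Longrightarrow> g z = a * f1 z + b * f2 z" "f1 \<in> chi_span" "f2 \<in> chi_span"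
  shows "g \<in> chi_span"
  using chi_span_cong[OF chi_span_add[OF chi_span_scale chi_span_scale]] assms by metis

lemma chi_span_sum:
  assumes "\<And>n. g n \<in> chi_span"
  shows "(\<lambda>z. \<Sum>n<(K::nat). c n * g n z) \<in> chi_span"
proof (induction K)
  case 0
  show ?case unfolding chi_span_def by (intro CollectI exI[of _ 0]) simp
next
  case (Suc K)
  then show ?case using chi_span_add[OF Suc chi_span_scale[OF assms]] by simp
qed

lemma cnj_chi_in_span: "(\<lambda>z. cnj (chi n z)) \<in> chi_span"
proof (cases "odd n")
  case True
  show ?thesis
  proof (rule chi_span_lincomb)
    show "cnj (chi n z) = \<alpha> n * chi n z + \<rho> n * chi (Suc n) z" if "cmod z = 1" for z
      using arg_cong[OF chi_odd[OF that True], of cnj] by simp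
  qed (rule chi_in_span)+
next
  case False
  show ?thesis
  proof (cases n)
    case 0
    then show ?thesis by (intro chi_span_cong[OF chi_in_span[of 0]]) (simp add: chi_0)
  next
    case (Suc m)
    then have m: "odd m" using False by simp
    show ?thesis
    proof (rule chi_span_lincomb)
      show "cnj (chi n z) = \<rho> m * chi m z + (- cnj (\<alpha> m)) * chi n z" if "cmod z = 1" for z
        using arg_cong[OF chi_Suc_odd[OF that m], of cnj] by (simp add: Suc)
    qed (rule chi_in_span)+
  qed
qed

lemma cnj_mult_chi_cases:
  "\<exists>a b j k. \<forall>z. cmod z = 1 \<longrightarrow> cnj z * chi n z = a * cnj (chi j z) + b * cnj (chi k z)"
proof (cases "even n")
  case True
  then show ?thesis using chi_even by blast
next
  case False
  then obtain m where m: "n = Suc m" by (metis even_zero old.nat.exhaust)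
  then have "even m" using False by simp
  have "cnj z * chi n z = \<rho> m * cnj (chi m z) + (- cnj (\<alpha> m)) * cnj (chi n z)" if "cmod z = 1" for z
    using chi_Suc_even[OF that \<open>even m\<close>] by (simp add: m)
  then show ?thesis by blast
qed

lemma cnj_mult_chi_in_span: "(\<lambda>z. cnj z * chi n z) \<in> chi_span"
proof -
  obtain a b j k where "\<And>z. cmod z = 1 \<Longrightarrow> cnj z * chi n z = a * cnj (chi j z) + b * cnj (chi k z)"
    using cnj_mult_chi_cases[of n] by blast
  then show ?thesis by (rule chi_span_lincomb) (auto intro: cnj_chi_in_span)
qed

lemma mult_cnj_chi_in_span: "(\<lambda>z. z * cnj (chi n z)) \<in> chi_span"
proof -
  obtain a b j k where *: "\<And>z. cmod z = 1 \<Longrightarrow> cnj z * chi n z = a * cnj (chi j z) + b * cnj (chi k z)"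
    using cnj_mult_chi_cases[of n] by blast
  have "z * cnj (chi n z) = cnj a * chi j z + cnj b * chi k z" if "cmod z = 1" for z
    using arg_cong[OF *[OF that], of cnj] by simp
  then show ?thesis by (rule chi_span_lincomb) (auto intro: chi_in_span)
qed

text \<open>Two blocks in succession: an odd one leads from \<open>chi\<close> to the conjugates, an
  even one absorbs \<open>z\<close> on the way back. Index 0 lies in no odd block, but
  \<open>chi 0\<close> is constantly 1 and so its own conjugate.\<close>

lemma mult_chi_in_span: "(\<lambda>z. z * chi n z) \<in> chi_span"
proof (cases "odd n")
  case True
  show ?thesis
  proof (rule chi_span_lincomb)
    show "z * chi n z = cnj (\<alpha> n) * (z * cnj (chi n z)) + \<rho> n * (z * cnj (chi (Suc n) z))"
      if "cmod z = 1" for z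
      using arg_cong[OF chi_odd[OF that True], of "\<lambda>u. z * u"] by (simp add: algebra_simps)
  qed (rule mult_cnj_chi_in_span)+
next
  case False
  show ?thesis
  proof (cases n)
    case 0
    then show ?thesis by (intro chi_span_cong[OF mult_cnj_chi_in_span[of 0]]) (simp add: chi_0)
  next
    case (Suc m)
    then have m: "odd m" using False by simp
    show ?thesis
    proof (rule chi_span_lincomb)
      show "z * chi n z = \<rho> m * (z * cnj (chi m z)) + (- \<alpha> m) * (z * cnj (chi n z))"
        if "cmod z = 1" for z
        using arg_cong[OF chi_Suc_odd[OF that m], of "\<lambda>u. z * u"] by (simp add: Suc algebra_simps)
    qed (rule mult_cnj_chi_in_span)+
  qed
qed

lemma chi_span_mult:
  assumes f: "f \<in> chi_span" and h: "\<And>n. (\<lambda>z. h z * chi n z) \<in> chi_span"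
  shows "(\<lambda>z. h z * f z) \<in> chi_span"
proof -
  obtain K c where c: "\<And>z. cmod z = 1 \<Longrightarrow> f z = (\<Sum>n<K. c n * chi n z)"
    using f by (auto simp: chi_span_def)
  show ?thesis
    by (rule chi_span_cong[OF chi_span_sum[where g = "\<lambda>n z. h z * chi n z" and K = K and c = c, OF h]])
      (simp add: c sum_distrib_left mult_ac)
qed

text \<open>Keeping \<open>f\<close> arbitrary lets the product case apply the hypothesis for
  \<open>p\<close> to \<open>q\<close> times \<open>f\<close>, so that closure under
  \<open>z\<close> and \<open>cnj z\<close> is enough.\<close>

lemma chi_span_real_polynomial:
  assumes "real_polynomial_function p"
  shows "f \<in> chi_span \<Longrightarrow> (\<lambda>z. complex_of_real (p z) * f z) \<in> chi_span"
  using assms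
proof (induction p arbitrary: f rule: real_polynomial_function.induct)
  case (linear p)
  interpret bounded_linear p by fact
  \<comment> \<open>A real-linear form is \<open>a * z + cnj a * cnj z\<close>; the values at 1 and
    \<open>\<i>\<close> determine \<open>a\<close>.\<close>
  define a where "a = (complex_of_real (p 1) - \<i> * complex_of_real (p \<i>)) / 2"
  have eq: "complex_of_real (p z) * f z = a * (z * f z) + cnj a * (cnj z * f z)" for z
  proof -
    have "p z = p (Re z *\<^sub>R 1 + Im z *\<^sub>R \<i>)"
      by (rule arg_cong[of _ _ p]) (simp add: complex_eq_iff)
    also have "\<dots> = Re z * p 1 + Im z * p \<i>" by (simp only: add scale real_scaleR_def)
    finally have "complex_of_real (p z) = a * z + cnj a * cnj z"
      by (simp add: a_def complex_eq_iff field_simps)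
    then show ?thesis by (simp add: algebra_simps)
  qed
  show ?case
    by (rule chi_span_lincomb[OF eq chi_span_mult[OF linear.prems mult_chi_in_span]
          chi_span_mult[OF linear.prems cnj_mult_chi_in_span]])
next
  case (const c)
  then show ?case by (rule chi_span_scale)
next
  case (add p q)
  then show ?case
    using chi_span_add[OF add.IH(1)[OF add.prems] add.IH(2)[OF add.prems]] by (simp add: ring_distribs)
next
  case (mult p q)
  then show ?case
    using mult.IH(1)[OF mult.IH(2)[OF mult.prems]] by (simp add: mult.assoc)
qed

lemma chi_sum_dense:
  fixes f :: "complex \<Rightarrow> real"
  assumes "continuous_on UNIV f" "0 < e"
  obtains K c where "\<And>z. cmod z = 1 \<Longrightarrow> cmod (of_real (f z) - (\<Sum>n<K. c n * chi n z)) \<le> e"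
proof -
  obtain p where p: "real_polynomial_function p" "\<And>z. z \<in> sphere 0 1 \<Longrightarrow> \<bar>f z - p z\<bar> < e"
    using Stone_Weierstrass_real_polynomial_function[of "sphere 0 1" f e] assms
      continuous_on_subset[OF assms(1), of "sphere 0 1"] by auto
  have "(\<lambda>z. complex_of_real (p z) * chi 0 z) \<in> chi_span"
    by (rule chi_span_real_polynomial[OF p(1) chi_in_span])
  then obtain K c where c: "\<And>z. cmod z = 1 \<Longrightarrow> complex_of_real (p z) = (\<Sum>n<K. c n * chi n z)"
    by (auto simp: chi_span_def chi_0)
  have "cmod (of_real (f z) - (\<Sum>n<K. c n * chi n z)) \<le> e" if "cmod z = 1" for z
  proof -
    have "cmod (of_real (f z) - (\<Sum>n<K. c n * chi n z)) = \<bar>f z - p z\<bar>"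
      unfolding c[OF that, symmetric] by (metis norm_of_real of_real_diff)
    then show ?thesis using p(2)[of z] that by simp
  qed
  then show ?thesis by (rule that)
qed

end

section \<open>The support of the measure\<close>

lemma in_derived_set_of_euclidean: "x \<in> euclidean derived_set_of S \<longleftrightarrow> x islimpt S"
  unfolding in_derived_set_of islimpt_def by auto

context nontrivial_circle_measure
begin

lemma measure_supp_subset: "measure_supp M \<subseteq> sphere 0 1"
  by (auto simp: measure_supp_def space_M)

lemma measure_supp_pos:
  assumes "z \<in> measure_supp M" "open U" "z \<in> U"
  shows "0 < measure M (U \<inter> space M)"
  using assms unfolding measure_supp_def
  by (auto simp: emeasure_eq_measure)

lemma closed_measure_supp: "closed (measure_supp M)"
  unfolding closed_limpt
proof (intro allI impI)
  fix x assume x: "x islimpt measure_supp M"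
  have "x islimpt sphere 0 1"
    using islimpt_subset[OF x measure_supp_subset] .
  then have "x \<in> space M"
    by (simp add: space_M) (metis closed_limpt closed_sphere mem_sphere_0)
  moreover have "0 < emeasure M (U \<inter> space M)" if "open U" "x \<in> U" for U
    using x that unfolding islimpt_def measure_supp_def by blast
  ultimately show "x \<in> measure_supp M" unfolding measure_supp_def by blast
qed

text \<open>Each point outside the support has a null open neighbourhood, and by Lindelof countably
  many of the null open sets cover the union of all of them.\<close>

lemma AE_not_in_open:
  assumes T: "open T" "T \<inter> measure_supp M = {}"
  shows "AE z in M. z \<notin> T"
proof -
  define F where "F = {U. open U \<and> emeasure M (U \<inter> space M) = 0}"
  obtain F' where F': "F' \<subseteq> F" "countable F'" "\<Union>F' = \<Union>F"
    using Lindelof[of F] by (auto simp: F_def)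
  have "(\<Union>U\<in>F'. U \<inter> space M) \<in> null_sets M"
  proof (intro null_sets_UN' F'(2))
    fix U assume "U \<in> F'"
    then have "open U" "emeasure M (U \<inter> space M) = 0" using F'(1) by (auto simp: F_def)
    then show "U \<inter> space M \<in> null_sets M"
      by (intro null_setsI borel_Int_space_in_sets) auto
  qed
  then have "AE z in M. z \<notin> (\<Union>U\<in>F'. U \<inter> space M)" by (rule AE_not_in)
  then show ?thesis
  proof (rule AE_mp, intro AE_I2 impI notI)
    fix z assume z: "z \<in> space M" "z \<notin> (\<Union>U\<in>F'. U \<inter> space M)" "z \<in> T"
    then have "z \<notin> measure_supp M" using T by auto
    then obtain U where "open U" "z \<in> U" "\<not> 0 < emeasure M (U \<inter> space M)"
      using z(1) by (auto simp: measure_supp_def)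
    then have "z \<in> \<Union>F" by (auto simp: F_def)
    then show False using z F'(3) by auto
  qed
qed

section \<open>Weyl vectors force limit points\<close>

lemma integral_indicator_scaled:
  fixes a :: real
  assumes "A \<in> sets M"
  shows "integrable M (\<lambda>z. a * indicator A z)" "(LINT z|M. a * indicator A z) = a * measure M A"
  using assms sets.sets_into_space[OF assms]
  by (auto simp: Int_absorb2 emeasure_eq_measure intro!: integrable_mult_right integrable_real_indicator)

lemma singleton_in_sets: "cmod w = 1 \<Longrightarrow> {w} \<in> sets M"
  using borel_Int_space_in_sets[of "{w}"] by (simp add: space_M)

text \<open>The test function is the reproducing kernel \<open>u\<close> at \<open>w\<close>: both
  its value at \<open>w\<close> and its squared norm equal \<open>s\<close>, so the atom alone
  contributes \<open>s^2\<close> times its mass to an integral equal to \<open>s\<close>.\<close>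

lemma chi_bessel:
  assumes w: "cmod w = 1"
  shows "measure M {w} * (\<Sum>n<K. (cmod (chi n w))\<^sup>2) \<le> 1"
proof -
  define s where "s = (\<Sum>n<K. (cmod (chi n w))\<^sup>2)"
  define u where "u z = (\<Sum>n<K. cnj (chi n w) * chi n z)" for z
  have "u w = complex_of_real s"
    unfolding u_def s_def of_real_sum by (intro sum.cong refl) (simp only: complex_norm_square mult.commute)
  moreover have s0: "0 \<le> s" unfolding s_def by (intro sum_nonneg) auto
  ultimately have uw: "cmod (u w) = s" by simp
  have "(LINT z|M. s\<^sup>2 * indicator {w} z) \<le> (LINT z|M. (cmod (u z))\<^sup>2)"
  proof (intro integral_mono integral_indicator_scaled singleton_in_sets w)
    show "integrable M (\<lambda>z. (cmod (u z))\<^sup>2)"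
      unfolding u_def by (intro integrable_circle continuous_intros)
    show "s\<^sup>2 * indicator {w} z \<le> (cmod (u z))\<^sup>2" for z
      using uw by (auto simp: indicator_def)
  qed
  also have "(LINT z|M. (cmod (u z))\<^sup>2) = s"
    unfolding u_def integral_norm_chi_sum s_def by simp
  finally have "s\<^sup>2 * measure M {w} \<le> s"
    by (simp only: integral_indicator_scaled(2)[OF singleton_in_sets[OF w]])
  then have "s * (s * measure M {w}) \<le> s * 1"
    by (simp add: power2_eq_square mult.assoc)
  then have "s = 0 \<or> s * measure M {w} \<le> 1"
    using s0 by (metis less_eq_real_def mult_le_cancel_left_pos)
  then show ?thesis by (auto simp: s_def[symmetric] mult.commute)
qed

text \<open>If \<open>w\<close> is not a limit point of the support, the measure near \<open>w\<close> is at most an atom at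
  \<open>w\<close>, and by Bessel's inequality trial vectors far out in the basis barely see that atom.\<close>

lemma weyl_point_imp_islimpt:
  assumes w: "cmod w = 1" and W: "weyl_point \<alpha> w"
  shows "w islimpt measure_supp M"
proof (rule ccontr)
  assume "\<not> w islimpt measure_supp M"
  then obtain r where r: "r > 0" "\<And>y. y \<in> measure_supp M \<Longrightarrow> dist y w < r \<Longrightarrow> y = w"
    unfolding islimpt_approachable by blast
  have "open (ball w r - {w})" by (intro open_Diff) auto
  then have ae: "AE z in M. z \<notin> ball w r - {w}"
    using r(2) by (intro AE_not_in_open) (auto simp: dist_commute)
  define m where "m = measure M {w}"
  have m0: "0 \<le> m" by (simp add: m_def)
  \<comment> \<open>Bessel bounds the partial sums by 1, so the tails are small; a vector that
    starts far out meets only a tail.\<close>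
  have "summable (\<lambda>n. m * (cmod (chi n w))\<^sup>2)"
    by (rule summableI_nonneg_bounded[of _ 1])
      (use chi_bessel[OF w] in \<open>simp_all add: m_def flip: sum_distrib_left\<close>)
  then obtain N where N: "\<And>k K. N \<le> k \<Longrightarrow> norm (\<Sum>n=k..<K. m * (cmod (chi n w))\<^sup>2) < 1/2"
    unfolding summable_Cauchy by (metis half_gt_zero zero_less_one)
  \<comment> \<open>The part away from \<open>w\<close> will contribute at most
    \<open>r^2 / 4 * C\<close> and the atom at most \<open>r^2 / 2 * C\<close>, too little to
    dominate \<open>r^2 * C\<close>. Starting at \<open>Suc N\<close> also secures
    \<open>c 0 = 0\<close>.\<close>
  have "r\<^sup>2 / 4 > 0" using r(1) by simp
  with W obtain K c where cN: "\<forall>n < Suc N. c n = 0" and cK: "\<forall>n\<ge>K. c n = 0"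
    and pos: "0 < (\<Sum>n<K. (cmod (c n))\<^sup>2)"
    and le: "(\<Sum>n\<le>K. (cmod (jac \<alpha> w c n))\<^sup>2) \<le> r\<^sup>2 / 4 * (\<Sum>n<K. (cmod (c n))\<^sup>2)"
    unfolding weyl_point_def by blast
  define C where "C = (\<Sum>n<K. (cmod (c n))\<^sup>2)"
  define u where "u z = (\<Sum>n<K. c n * chi n z)" for z
  have "cmod (u w) \<le> (\<Sum>n<K. cmod (c n) * cmod (chi n w))"
    unfolding u_def by (rule sum_norm_le) (simp add: norm_mult)
  also have "\<dots> = (\<Sum>n=N..<K. cmod (c n) * cmod (chi n w))"
    using cN by (intro sum.mono_neutral_right) (auto simp: not_le)
  finally have "(cmod (u w))\<^sup>2 \<le> (\<Sum>n=N..<K. cmod (c n) * cmod (chi n w))\<^sup>2"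
    by (intro power_mono) auto
  also have "\<dots> \<le> (\<Sum>n=N..<K. (cmod (c n))\<^sup>2) * (\<Sum>n=N..<K. (cmod (chi n w))\<^sup>2)"
    by (rule Cauchy_Schwarz_ineq_sum)
  also have "\<dots> \<le> C * (\<Sum>n=N..<K. (cmod (chi n w))\<^sup>2)"
    unfolding C_def by (intro mult_right_mono sum_mono2 sum_nonneg) auto
  finally have "m * (cmod (u w))\<^sup>2 \<le> m * (C * (\<Sum>n=N..<K. (cmod (chi n w))\<^sup>2))"
    by (intro mult_left_mono m0)
  also have "\<dots> = C * (\<Sum>n=N..<K. m * (cmod (chi n w))\<^sup>2)"
    by (simp add: sum_distrib_left mult_ac)
  also have "\<dots> \<le> C * (1/2)"
    using N[of N K] pos by (intro mult_left_mono) (auto simp: C_def)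
  finally have mu: "m * (cmod (u w))\<^sup>2 \<le> C / 2" by simp
  have i1: "integrable M (\<lambda>z. r\<^sup>2 * (cmod (u z))\<^sup>2)"
    and i2: "integrable M (\<lambda>z. (cmod (z - w))\<^sup>2 * (cmod (u z))\<^sup>2)"
    unfolding u_def by (intro integrable_circle continuous_intros)+
  note i3 = integral_indicator_scaled[OF singleton_in_sets[OF w], of "r\<^sup>2 * (cmod (u w))\<^sup>2"]
  have "r\<^sup>2 * C = (LINT z|M. r\<^sup>2 * (cmod (u z))\<^sup>2)"
    by (simp add: u_def integral_norm_chi_sum C_def)
  also have "\<dots> \<le> (LINT z|M. (cmod (z - w))\<^sup>2 * (cmod (u z))\<^sup>2 + r\<^sup>2 * (cmod (u w))\<^sup>2 * indicator {w} z)"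
  proof (rule integral_mono_AE[OF i1 Bochner_Integration.integrable_add[OF i2 i3(1)]])
    show "AE z in M. r\<^sup>2 * (cmod (u z))\<^sup>2
        \<le> (cmod (z - w))\<^sup>2 * (cmod (u z))\<^sup>2 + r\<^sup>2 * (cmod (u w))\<^sup>2 * indicator {w} z"
      using ae
    proof (rule AE_mp, intro AE_I2 impI)
      fix z assume z: "z \<notin> ball w r - {w}"
      show "r\<^sup>2 * (cmod (u z))\<^sup>2
        \<le> (cmod (z - w))\<^sup>2 * (cmod (u z))\<^sup>2 + r\<^sup>2 * (cmod (u w))\<^sup>2 * indicator {w} z"
      proof (cases "z = w")
        case False
        then have "r \<le> cmod (z - w)" using z by (simp add: dist_norm norm_minus_commute)
        then have "r\<^sup>2 \<le> (cmod (z - w))\<^sup>2" using r(1) by (intro power_mono) auto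
        then show ?thesis using False by (simp add: mult_right_mono)
      qed simp
    qed
  qed
  also have "\<dots> = (\<Sum>n\<le>K. (cmod (jac \<alpha> w c n))\<^sup>2) + r\<^sup>2 * (cmod (u w))\<^sup>2 * m"
    unfolding Bochner_Integration.integral_add[OF i2 i3(1)] i3(2) m_def[symmetric]
    unfolding u_def using cN cK by (subst integral_norm_jac) auto
  also have "\<dots> \<le> r\<^sup>2 / 4 * C + r\<^sup>2 * (C / 2)"
    using le mu unfolding C_def[symmetric] mult.assoc
    by (intro add_mono mult_left_mono) (auto simp: mult.commute)
  finally have "r\<^sup>2 * C \<le> 3 / 4 * (r\<^sup>2 * C)" by (simp add: field_simps)
  moreover have "0 < r\<^sup>2 * C" using pos r(1) by (simp add: C_def)
  ultimately show False by linarith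
qed

section \<open>Limit points produce Weyl vectors\<close>

lemma chi_bounded: "\<exists>B\<ge>1. \<forall>n<N. \<forall>z. cmod z = 1 \<longrightarrow> cmod (chi n z) \<le> B"
proof (induction N)
  case (Suc N)
  then obtain B where B: "B \<ge> 1" "\<forall>n<N. \<forall>z. cmod z = 1 \<longrightarrow> cmod (chi n z) \<le> B" by blast
  have "compact (chi N ` sphere 0 1)"
    by (intro compact_continuous_image continuous_intros) auto
  then obtain B' where B': "\<And>z. z \<in> sphere 0 1 \<Longrightarrow> cmod (chi N z) \<le> B'"
    using compact_imp_bounded bounded_iff by (metis imageI)
  show ?case
    by (rule exI[of _ "max B B'"]) (use B B' in \<open>auto simp: less_Suc_eq le_max_iff_disj\<close>)
qed auto

text \<open>The ball is punctured because \<open>w\<close> may be an atom: punctured balls shrink to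
  the empty set, so continuity from above gives measures tending to 0.\<close>

lemma small_punctured_ball:
  assumes "0 < \<kappa>" "0 < r"
  obtains d where "0 < d" "d \<le> r" "measure M ((ball w d - {w}) \<inter> space M) < \<kappa>"
proof -
  define A where "A i = (ball w (inverse (real (Suc i))) - {w}) \<inter> space M" for i
  have "decseq A"
  proof (rule decseq_SucI)
    fix i
    have "inverse (real (Suc (Suc i))) \<le> inverse (real (Suc i))"
      by (intro le_imp_inverse_le) auto
    then show "A (Suc i) \<le> A i" using subset_ball unfolding A_def by blast
  qed
  moreover have "range A \<subseteq> sets M"
    unfolding A_def by (auto intro!: borel_Int_space_in_sets)
  moreover have "(\<Inter>i. A i) = {}"
  proof -
    have False if z: "\<And>i. z \<in> A i" for z
    proof -
      have "0 < dist w z" using z[of 0] by (auto simp: A_def)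
      then obtain i where "inverse (real (Suc i)) < dist w z" using reals_Archimedean by blast
      then show False using z[of i] by (simp add: A_def)
    qed
    then show ?thesis by auto
  qed
  ultimately have "(\<lambda>i. measure M (A i)) \<longlonglongrightarrow> 0"
    using finite_Lim_measure_decseq[of A] by simp
  then have "\<forall>\<^sub>F i in sequentially. measure M (A i) < \<kappa>"
    using assms(1) by (rule order_tendstoD)
  moreover have "\<forall>\<^sub>F i in sequentially. inverse (real (Suc i)) < r"
    using LIMSEQ_inverse_real_of_nat assms(2) by (rule order_tendstoD)
  ultimately have "\<forall>\<^sub>F i in sequentially. measure M (A i) < \<kappa> \<and> inverse (real (Suc i)) < r"
    by (rule eventually_conj)
  then obtain i where "measure M (A i) < \<kappa>" "inverse (real (Suc i)) < r"
    unfolding eventually_sequentially by blast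
  then show ?thesis using that[of "inverse (real (Suc i))"] by (simp add: A_def)
qed

text \<open>A bump on a set of measure at most \<open>\<kappa>\<close> has small \<open>L\<^sup>1\<close> norm relative to its
  \<open>L\<^sup>2\<close> norm, so it is almost orthogonal to any fixed bounded functions.\<close>

lemma bump_near_limit_point:
  assumes w: "w islimpt measure_supp M" and "0 < \<kappa>" "0 < r"
  obtains f :: "complex \<Rightarrow> real" where "continuous_on UNIV f" "\<And>z. 0 \<le> f z"
    "\<And>z. r \<le> cmod (z - w) \<Longrightarrow> f z = 0" "(LINT z|M. (f z)\<^sup>2) = 1" "(LINT z|M. f z) \<le> sqrt \<kappa>"
proof -
  obtain d where d: "0 < d" "d \<le> r" "measure M ((ball w d - {w}) \<inter> space M) < \<kappa>"
    by (rule small_punctured_ball[OF assms(2,3)])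
  \<comment> \<open>A small ball around a support point \<open>v \<noteq> w\<close> has positive
    measure, stays inside the set of measure below \<open>\<kappa>\<close>, and misses a possible
    atom at \<open>w\<close>.\<close>
  obtain v where v: "v \<in> measure_supp M" "v \<noteq> w" "dist v w < d"
    using w d(1) unfolding islimpt_approachable by blast
  have "open (ball w d - {w})" by (intro open_Diff) auto
  moreover have "v \<in> ball w d - {w}" using v by (auto simp: dist_commute)
  ultimately obtain \<eta> where \<eta>: "0 < \<eta>" "ball v \<eta> \<subseteq> ball w d - {w}"
    by (rule openE)
  define U where "U = ball v \<eta> \<inter> space M"
  have U: "U \<in> sets M" unfolding U_def by (intro borel_Int_space_in_sets) auto
  have mU: "measure M U \<le> \<kappa>"
  proof -
    have "measure M U \<le> measure M ((ball w d - {w}) \<inter> space M)"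
      using \<eta>(2) unfolding U_def by (intro finite_measure_mono borel_Int_space_in_sets) auto
    then show ?thesis using d(3) by simp
  qed
  define g where "g z = max 0 (\<eta> - dist v z)" for z
  have g: "continuous_on UNIV g" unfolding g_def by (intro continuous_intros)
  define G where "G = (LINT z|M. (g z)\<^sup>2)"
  have "0 < G"
  proof -
    define V where "V = ball v (\<eta> / 2) \<inter> space M"
    have V: "V \<in> sets M" unfolding V_def by (intro borel_Int_space_in_sets) auto
    have "0 < measure M V"
      unfolding V_def using \<eta>(1) by (intro measure_supp_pos[OF v(1)]) auto
    then have "0 < (LINT z|M. (\<eta> / 2)\<^sup>2 * indicator V z)"
      unfolding integral_indicator_scaled(2)[OF V] using \<eta>(1) by simp
    also have "\<dots> \<le> G"
      unfolding G_def
    proof (intro integral_mono integral_indicator_scaled V integrable_circle continuous_intros g)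
      show "(\<eta> / 2)\<^sup>2 * indicator V z \<le> (g z)\<^sup>2" for z
      proof (cases "z \<in> V")
        case True
        then have "\<eta> / 2 \<le> \<eta> - dist v z" by (auto simp: V_def)
        then have "\<eta> / 2 \<le> g z" unfolding g_def by (rule max.coboundedI2)
        then have "(\<eta> / 2)\<^sup>2 \<le> (g z)\<^sup>2" using \<eta>(1) by (intro power_mono) auto
        then show ?thesis using True by simp
      qed simp
    qed
    finally show ?thesis .
  qed
  define f where "f z = g z / sqrt G" for z
  have f: "continuous_on UNIV f"
    unfolding f_def using \<open>0 < G\<close> by (intro continuous_intros g) auto
  have f0: "0 \<le> f z" for z using \<open>0 < G\<close> by (simp add: f_def g_def)
  have fU: "f z = 0" if "z \<notin> ball v \<eta>" for z using that by (simp add: f_def g_def)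
  have f1: "(LINT z|M. (f z)\<^sup>2) = 1"
    using \<open>0 < G\<close> by (simp add: f_def power_divide flip: G_def)
  \<comment> \<open>A pointwise arithmetic-geometric mean inequality with weight
    \<open>sqrt \<kappa>\<close>; each of the two summands integrates to at most
    \<open>sqrt \<kappa> / 2\<close>.\<close>
  have "(LINT z|M. f z) \<le> (LINT z|M. sqrt \<kappa> / 2 * (f z)\<^sup>2 + 1 / (2 * sqrt \<kappa>) * indicator U z)"
  proof (intro integral_mono Bochner_Integration.integrable_add integral_indicator_scaled U
      integrable_circle continuous_intros f)
    fix z assume "z \<in> space M"
    show "f z \<le> sqrt \<kappa> / 2 * (f z)\<^sup>2 + 1 / (2 * sqrt \<kappa>) * indicator U z"
    proof (cases "z \<in> ball v \<eta>")
      case True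
      define s where "s = sqrt \<kappa>"
      have "0 < s" using assms(2) by (simp add: s_def)
      have "2 * (s * f z) \<le> (s * f z)\<^sup>2 + 1"
        using sum_squares_bound[of "s * f z" 1] by simp
      then have "f z \<le> s / 2 * (f z)\<^sup>2 + 1 / (2 * s)"
        using \<open>0 < s\<close> by (simp add: field_simps power2_eq_square)
      then show ?thesis using True \<open>z \<in> space M\<close> by (simp add: U_def s_def)
    qed (use fU assms(2) in auto)
  qed
  also have "\<dots> = sqrt \<kappa> / 2 * 1 + 1 / (2 * sqrt \<kappa>) * measure M U"
  proof -
    have "integrable M (\<lambda>z. sqrt \<kappa> / 2 * (f z)\<^sup>2)"
      by (intro integrable_circle continuous_intros f)
    moreover have "(LINT z|M. sqrt \<kappa> / 2 * (f z)\<^sup>2) = sqrt \<kappa> / 2 * 1"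
      by (simp only: integral_mult_right_zero f1)
    ultimately show ?thesis
      by (simp only: Bochner_Integration.integral_add integral_indicator_scaled[OF U])
  qed
  also have "\<dots> \<le> sqrt \<kappa> / 2 * 1 + 1 / (2 * sqrt \<kappa>) * \<kappa>"
    using mU assms(2) by (intro add_left_mono mult_left_mono) auto
  also have "\<dots> = sqrt \<kappa>"
    using assms(2) by (simp add: field_simps flip: power2_eq_square)
  finally have "(LINT z|M. f z) \<le> sqrt \<kappa>" .
  moreover have "f z = 0" if "r \<le> cmod (z - w)" for z
  proof (rule fU)
    have "z \<notin> ball w d" using that d(2) by (simp add: dist_norm norm_minus_commute)
    then show "z \<notin> ball v \<eta>" using \<eta>(2) by auto
  qed
  ultimately show ?thesis using that f f0 f1 by blast
qed

text \<open>A bump \<open>f\<close> near \<open>w\<close> is approximated uniformly by a finite sum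
  \<open>g\<close>, from which the first terms \<open>h\<close> are cut off. These are small because
  the bump is almost orthogonal to each early \<open>chi n\<close>, so the rest \<open>u\<close>
  keeps enough mass and its concentration near \<open>w\<close>.\<close>

lemma islimpt_imp_weyl_point:
  assumes w: "w islimpt measure_supp M"
  shows "weyl_point \<alpha> w"
  unfolding weyl_point_def
proof (intro allI impI)
  fix N and \<epsilon> :: real assume \<epsilon>: "\<epsilon> > 0"
  have nw: "cmod w = 1"
    using closed_measure_supp w measure_supp_subset unfolding closed_limpt by force
  \<comment> \<open>One more than \<open>N\<close>, so that \<open>c 0 = 0\<close>, as
    \<open>integral_norm_jac\<close> requires, even for \<open>N = 0\<close>.\<close>
  define L where "L = Suc N"
  obtain B where B: "B \<ge> 1" "\<And>n z. n < L \<Longrightarrow> cmod z = 1 \<Longrightarrow> cmod (chi n z) \<le> B"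
    using chi_bounded[of L] by blast
  \<comment> \<open>The squared distance of \<open>u\<close> from \<open>f\<close> will be at most
    \<open>4 * \<theta>\<close>. The bound 1/16 leaves \<open>u\<close> a squared norm of at least
    1/4. The bound \<open>\<epsilon> / 256\<close> makes the error term \<open>32 * \<theta>\<close>
    at most \<open>\<epsilon> / 8\<close>, and \<open>2 * r^2\<close> is the other
    \<open>\<epsilon> / 8\<close>.\<close>
  define \<theta> where "\<theta> = min (1 / 16) (\<epsilon> / 256)"
  have \<theta>: "0 < \<theta>" "\<theta> \<le> 1 / 16" "\<theta> \<le> \<epsilon> / 256" using \<epsilon> by (auto simp: \<theta>_def)
  \<comment> \<open>At most \<open>L\<close> coefficients are cut off, each of modulus at most
    \<open>2 * B * sqrt \<kappa>\<close>, so their squares add up to at most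
    \<open>\<theta>\<close>.\<close>
  define \<kappa> where "\<kappa> = \<theta> / (4 * real L * B\<^sup>2)"
  have X: "0 < 4 * real L * B\<^sup>2" using B by (simp add: L_def)
  have \<kappa>: "0 < \<kappa>" "4 * real L * B\<^sup>2 * \<kappa> = \<theta>"
    unfolding \<kappa>_def using X divide_pos_pos[OF \<theta>(1) X]
    by (blast, metis less_irrefl nonzero_mult_div_cancel_left times_divide_eq_right)
  have "1 * \<kappa> \<le> 4 * real L * B\<^sup>2 * \<kappa>"
  proof (intro mult_right_mono)
    have "1 * 1 \<le> (4 * real L) * B\<^sup>2" using B by (intro mult_mono) (auto simp: L_def)
    then show "1 \<le> 4 * real L * B\<^sup>2" by simp
  qed (use \<kappa> in auto)
  then have \<kappa>\<theta>: "\<kappa> \<le> \<theta>" using \<kappa>(2) by simp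
  define r where "r = sqrt \<epsilon> / 4"
  have r: "0 < r" "r\<^sup>2 = \<epsilon> / 16" using \<epsilon> by (simp_all add: r_def power_divide)
  obtain f :: "complex \<Rightarrow> real" where f: "continuous_on UNIV f" "\<And>z. 0 \<le> f z"
    "\<And>z. r \<le> cmod (z - w) \<Longrightarrow> f z = 0" "(LINT z|M. (f z)\<^sup>2) = 1" "(LINT z|M. f z) \<le> sqrt \<kappa>"
    using bump_near_limit_point[OF w \<kappa>(1) r(1)] by blast
  have "0 < sqrt \<kappa>" using \<kappa>(1) by simp
  then obtain K d where
    gf: "\<And>z. cmod z = 1 \<Longrightarrow> cmod (of_real (f z) - (\<Sum>n<K. d n * chi n z)) \<le> sqrt \<kappa>"
    using chi_sum_dense[OF f(1)] by blast
  define g where "g z = (\<Sum>n<K. d n * chi n z)" for z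
  define c where "c n = (if L \<le> n \<and> n < K then d n else 0)" for n
  define e where "e n = (if n < L then d n else 0)" for n
  define u where "u z = (\<Sum>n<K. c n * chi n z)" for z
  define h where "h z = (\<Sum>n<K. e n * chi n z)" for z
  have guh: "g z = u z + h z" for z
    unfolding g_def u_def h_def sum.distrib[symmetric]
    by (intro sum.cong refl) (auto simp: c_def e_def)
  have cont: "continuous_on UNIV g" "continuous_on UNIV u" "continuous_on UNIV h"
    unfolding g_def u_def h_def by (intro continuous_intros)+
  have gf': "cmod (g z - of_real (f z)) \<le> sqrt \<kappa>" if "cmod z = 1" for z
    using gf[OF that] by (simp add: g_def norm_minus_commute)
  \<comment> \<open>One \<open>B * sqrt \<kappa>\<close> comes from the integral of
    \<open>f\<close>, the other from the uniform error of \<open>g\<close> under a probability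
    measure.\<close>
  have dn: "cmod (d n) \<le> 2 * B * sqrt \<kappa>" if n: "n < L" "n < K" for n
  proof -
    have "cmod (d n) = cmod (LINT z|M. cnj (chi n z) * g z)"
      unfolding g_def integral_chi_sum[OF n(2)] ..
    also have "\<dots> \<le> (LINT z|M. cmod (cnj (chi n z) * g z))"
      by (rule integral_norm_bound)
    also have "\<dots> \<le> (LINT z|M. B * f z + B * sqrt \<kappa>)"
    proof (intro integral_mono integrable_circle continuous_intros cont f)
      fix z assume "z \<in> space M"
      then have z: "cmod z = 1" by (rule norm_space)
      have "cmod (g z) \<le> cmod (of_real (f z)) + cmod (g z - of_real (f z))"
        by (metis add.commute diff_add_cancel norm_triangle_ineq)
      also have "\<dots> \<le> f z + sqrt \<kappa>" using gf'[OF z] f(2)[of z] by simp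
      finally have "cmod (chi n z) * cmod (g z) \<le> B * (f z + sqrt \<kappa>)"
        using B(2)[OF n(1) z] B(1) by (intro mult_mono) auto
      then show "cmod (cnj (chi n z) * g z) \<le> B * f z + B * sqrt \<kappa>"
        by (simp add: norm_mult ring_distribs)
    qed
    also have "\<dots> = B * (LINT z|M. f z) + B * sqrt \<kappa>"
      by (subst Bochner_Integration.integral_add)
        (auto intro!: integrable_circle continuous_intros f simp: prob_space)
    also have "\<dots> \<le> B * sqrt \<kappa> + B * sqrt \<kappa>"
      using f(5) B(1) by (intro add_right_mono mult_left_mono) auto
    finally show ?thesis by simp
  qed
  have int_h: "(LINT z|M. (cmod (h z))\<^sup>2) \<le> \<theta>"
  proof -
    have "(LINT z|M. (cmod (h z))\<^sup>2) = (\<Sum>n<K. (cmod (e n))\<^sup>2)"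
      unfolding h_def by (rule integral_norm_chi_sum)
    also have "\<dots> = (\<Sum>n\<in>{..<K} \<inter> {..<L}. (cmod (e n))\<^sup>2)"
      by (intro sum.mono_neutral_right) (auto simp: e_def)
    also have "\<dots> \<le> (\<Sum>n\<in>{..<K} \<inter> {..<L}. (2 * B * sqrt \<kappa>)\<^sup>2)"
      by (intro sum_mono power_mono) (auto simp: e_def dn)
    also have "\<dots> \<le> (\<Sum>n<L. (2 * B * sqrt \<kappa>)\<^sup>2)"
      by (intro sum_mono2) auto
    also have "\<dots> = \<theta>"
      using \<kappa> by (simp add: power_mult_distrib mult_ac)
    finally show ?thesis .
  qed
  define E where "E z = (cmod (u z - of_real (f z)))\<^sup>2" for z
  have E: "continuous_on UNIV E"
    unfolding E_def by (intro continuous_intros cont f)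
  have int_E: "(LINT z|M. E z) \<le> 4 * \<theta>"
  proof -
    have "(LINT z|M. E z) \<le> (LINT z|M. 2 * \<kappa> + 2 * (cmod (h z))\<^sup>2)"
    proof (intro integral_mono integrable_circle continuous_intros cont E)
      fix z assume "z \<in> space M"
      then have z: "cmod z = 1" by (rule norm_space)
      have "E z = (cmod ((g z - of_real (f z)) + (- h z)))\<^sup>2"
        by (simp add: E_def guh)
      also have "\<dots> \<le> 2 * (cmod (g z - of_real (f z)))\<^sup>2 + 2 * (cmod (- h z))\<^sup>2"
        by (rule power2_norm_add_le)
      also have "\<dots> \<le> 2 * (sqrt \<kappa>)\<^sup>2 + 2 * (cmod (h z))\<^sup>2"
        using gf'[OF z] by (simp add: power_mono del: real_sqrt_pow2_iff real_sqrt_pow2)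
      finally show "E z \<le> 2 * \<kappa> + 2 * (cmod (h z))\<^sup>2" using \<kappa>(1) by simp
    qed
    also have "\<dots> = 2 * \<kappa> + 2 * (LINT z|M. (cmod (h z))\<^sup>2)"
      by (subst Bochner_Integration.integral_add)
        (auto intro!: integrable_circle continuous_intros cont simp: prob_space)
    finally show ?thesis using \<kappa>\<theta> int_h by simp
  qed
  have int_u: "1 / 4 \<le> (LINT z|M. (cmod (u z))\<^sup>2)"
  proof -
    have "(LINT z|M. (f z)\<^sup>2) \<le> (LINT z|M. 2 * (cmod (u z))\<^sup>2 + 2 * E z)"
    proof (intro integral_mono integrable_circle continuous_intros cont E f)
      fix z
      have "(cmod (of_real (f z)))\<^sup>2 = (cmod (u z + - (u z - of_real (f z))))\<^sup>2" by simp
      also have "\<dots> \<le> 2 * (cmod (u z))\<^sup>2 + 2 * (cmod (- (u z - of_real (f z))))\<^sup>2"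
        by (rule power2_norm_add_le)
      finally show "(f z)\<^sup>2 \<le> 2 * (cmod (u z))\<^sup>2 + 2 * E z"
        unfolding norm_minus_cancel E_def by simp
    qed
    also have "\<dots> = 2 * (LINT z|M. (cmod (u z))\<^sup>2) + 2 * (LINT z|M. E z)"
      by (subst Bochner_Integration.integral_add)
        (auto intro!: integrable_circle continuous_intros cont E)
    finally show ?thesis using int_E \<theta>(2) f(4) by simp
  qed
  have "(LINT z|M. (cmod (z - w))\<^sup>2 * (cmod (u z))\<^sup>2) \<le> (LINT z|M. 2 * r\<^sup>2 * (f z)\<^sup>2 + 8 * E z)"
  proof (intro integral_mono integrable_circle continuous_intros cont E f)
    fix z assume "z \<in> space M"
    then have z: "cmod z = 1" by (rule norm_space)
    have "(cmod (u z))\<^sup>2 = (cmod (of_real (f z) + (u z - of_real (f z))))\<^sup>2" by simp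
    also have "\<dots> \<le> 2 * (cmod (of_real (f z)))\<^sup>2 + 2 * E z"
      unfolding E_def by (rule power2_norm_add_le)
    finally have "(cmod (u z))\<^sup>2 \<le> 2 * (f z)\<^sup>2 + 2 * E z" by simp
    then have "(cmod (z - w))\<^sup>2 * (cmod (u z))\<^sup>2 \<le> (cmod (z - w))\<^sup>2 * (2 * (f z)\<^sup>2 + 2 * E z)"
      by (intro mult_left_mono) auto
    also have "\<dots> = 2 * ((cmod (z - w))\<^sup>2 * (f z)\<^sup>2) + 2 * ((cmod (z - w))\<^sup>2 * E z)"
      by (simp add: algebra_simps)
    also have "\<dots> \<le> 2 * (r\<^sup>2 * (f z)\<^sup>2) + 2 * (2\<^sup>2 * E z)"
    proof (intro add_mono mult_left_mono[where c = 2])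
      show "(cmod (z - w))\<^sup>2 * (f z)\<^sup>2 \<le> r\<^sup>2 * (f z)\<^sup>2"
        using f(3)[of z] by (cases "r \<le> cmod (z - w)") (auto intro!: mult_right_mono power_mono)
      have "cmod (z - w) \<le> 2" using norm_triangle_ineq4[of z w] z nw by simp
      then show "(cmod (z - w))\<^sup>2 * E z \<le> 2\<^sup>2 * E z"
        by (intro mult_right_mono power_mono) (auto simp: E_def)
    qed auto
    finally show "(cmod (z - w))\<^sup>2 * (cmod (u z))\<^sup>2 \<le> 2 * r\<^sup>2 * (f z)\<^sup>2 + 8 * E z"
      by simp
  qed
  also have "\<dots> = 2 * r\<^sup>2 * (LINT z|M. (f z)\<^sup>2) + 8 * (LINT z|M. E z)"
    by (subst Bochner_Integration.integral_add)
      (auto intro!: integrable_circle continuous_intros f E)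
  also have "\<dots> \<le> \<epsilon> * (1 / 4)" using int_E \<theta>(3) f(4) r(2) by simp
  also have "\<dots> \<le> \<epsilon> * (LINT z|M. (cmod (u z))\<^sup>2)"
    using int_u \<epsilon> by (intro mult_left_mono) auto
  finally have *: "(LINT z|M. (cmod (z - w))\<^sup>2 * (cmod (u z))\<^sup>2) \<le> \<epsilon> * (LINT z|M. (cmod (u z))\<^sup>2)" .
  have "(\<Sum>n\<le>K. (cmod (jac \<alpha> w c n))\<^sup>2) \<le> \<epsilon> * (\<Sum>n<K. (cmod (c n))\<^sup>2)"
    using * unfolding u_def integral_norm_chi_sum
    by (subst (asm) integral_norm_jac) (auto simp: c_def L_def)
  moreover have "0 < (\<Sum>n<K. (cmod (c n))\<^sup>2)"
    using int_u unfolding u_def integral_norm_chi_sum by linarith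
  moreover have "\<forall>n<N. c n = 0" "\<forall>n\<ge>K. c n = 0" by (auto simp: c_def L_def)
  ultimately show "\<exists>K c. (\<forall>n<N. c n = 0) \<and> (\<forall>n\<ge>K. c n = 0) \<and> 0 < (\<Sum>n<K. (cmod (c n))\<^sup>2) \<and>
     (\<Sum>n\<le>K. (cmod (jac \<alpha> w c n))\<^sup>2) \<le> \<epsilon> * (\<Sum>n<K. (cmod (c n))\<^sup>2)"
    by blast
qed

section \<open>Comparison of the two supports\<close>

lemma derived_set_measure_supp:
  "euclidean derived_set_of measure_supp M = {w. cmod w = 1 \<and> weyl_point \<alpha> w}"
proof -
  have "w islimpt measure_supp M \<longleftrightarrow> cmod w = 1 \<and> weyl_point \<alpha> w" for w
    using islimpt_imp_weyl_point weyl_point_imp_islimpt closed_measure_supp measure_supp_subset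
    unfolding closed_limpt by force
  then show ?thesis using in_derived_set_of_euclidean by blast
qed

end

text \<open>A common limit point lies in both closed sets, hence not in the symmetric difference;
  and a limit point of that difference is one of \<open>A\<close> or of \<open>B\<close>, hence
  common.\<close>

lemma discrete_symmetric_difference:
  fixes A B :: "complex set"
  assumes "closed A" "closed B" "euclidean derived_set_of A = euclidean derived_set_of B"
  shows "discrete ((A - B) \<union> (B - A))"
proof (rule discreteI)
  have lp: "x islimpt A \<longleftrightarrow> x islimpt B" for x
    using assms(3) in_derived_set_of_euclidean by blast
  fix x assume x: "x \<in> (A - B) \<union> (B - A)"
  then have "\<not> x islimpt A" "\<not> x islimpt B"
    using assms(1,2) lp unfolding closed_limpt by blast+
  then have "\<not> x islimpt (A - B) \<union> (B - A)"
    by (meson Diff_subset islimpt_Un islimpt_subset)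
  then show "x isolated_in (A - B) \<union> (B - A)"
    using x by (simp add: isolated_in_islimpt_iff)
qed

theorem theorem3p4:
  fixes lam \<alpha> \<beta> :: "nat \<Rightarrow> complex" and \<mu> \<nu> :: "complex measure"
  assumes "\<And>n. lam n \<in> sphere 0 1"
    and "\<And>n. \<alpha> n \<in> ball 0 1" and "\<And>n. \<beta> n \<in> ball 0 1"
    and "circle_prob_measure \<mu>" and "\<not> finite_comb_of_deltas \<mu>"
    and "circle_prob_measure \<nu>" and "\<not> finite_comb_of_deltas \<nu>"
    and "\<And>n. verblunsky \<mu> n = \<alpha> n" and "\<And>n. verblunsky \<nu> n = \<beta> n"
    and "(\<lambda>n. \<beta> n * lam n - \<alpha> n) \<longlonglongrightarrow> 0"
    and "(\<lambda>n. lam (n - 1) * cnj (lam n)) \<longlonglongrightarrow> 1"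
  shows "euclidean derived_set_of measure_supp \<mu> = euclidean derived_set_of measure_supp \<nu> \<and>
         discrete ((measure_supp \<mu> - measure_supp \<nu>) \<union> (measure_supp \<nu> - measure_supp \<mu>))"
proof -
  interpret mu: nontrivial_circle_measure \<mu> using assms(4,5) by unfold_locales
  interpret nu: nontrivial_circle_measure \<nu> using assms(6,7) by unfold_locales
  have ab: "verblunsky \<mu> = \<alpha>" "verblunsky \<nu> = \<beta>" using assms(8,9) by auto
  have l: "cmod (lam n) = 1" and a: "cmod (\<alpha> n) < 1" and b: "cmod (\<beta> n) < 1" for n
    using assms(1,2,3)[of n] by simp_all
  \<comment> \<open>\<open>weyl_point_transfer\<close> goes one way only. The converse exchanges the
    two sequences and uses the inverse gauge \<open>cnj (lam n)\<close>, for which both conditions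
    are checked here.\<close>
  have "(\<lambda>n. cmod (\<alpha> n * cnj (lam n) - \<beta> n)) \<longlonglongrightarrow> 0"
    using tendsto_norm[OF assms(10)] norm_unit_mult_diff[OF l] by (simp add: mult.commute)
  then have lim1: "(\<lambda>n. \<alpha> n * cnj (lam n) - \<beta> n) \<longlonglongrightarrow> 0"
    by (rule tendsto_norm_zero_cancel)
  have lim2: "(\<lambda>n. cnj (lam (n - 1)) * cnj (cnj (lam n))) \<longlonglongrightarrow> 1"
    using tendsto_cnj[OF assms(11)] by simp
  have "weyl_point \<alpha> w \<longleftrightarrow> weyl_point \<beta> w" if "cmod w = 1" for w
    using weyl_point_transfer[OF l that a b assms(10,11)]
      weyl_point_transfer[of "\<lambda>n. cnj (lam n)", OF _ that b a lim1 lim2] l by auto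
  then have "euclidean derived_set_of measure_supp \<mu> = euclidean derived_set_of measure_supp \<nu>"
    unfolding mu.derived_set_measure_supp nu.derived_set_measure_supp ab by blast
  then show ?thesis
    using discrete_symmetric_difference mu.closed_measure_supp nu.closed_measure_supp by blast
qed

end
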